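(* Let $\alpha>-1$, $0<p\le q<\infty$ and let $\mu$ be a positive Borel measure on $\mathbb H$. Then the following two conditions are equivalent. (1) $A(p,\alpha)\hookrightarrow K^p_q(\mu)$, i.e. there is a constant $C>0$ such that $\|f\|_{K^p_q(\mu)}\le C\|f\|_{A(p,\alpha)}$ for all $f\in A(p,\alpha)$. (2) There is a constant $C>0$ such that $$\frac{\mu(\Delta_j)}{|\Delta_j|^{1+\frac{\alpha}{n+1}}}\le C,\qquad j\ge1.$$
   Context: $\mathbb H=\{(x,t):x\in\mathbb R^n,\ t>0\}\subset\mathbb R^{n+1}$; points are written $z=(x,t)$; $h(\mathbb H)$ is the space of harmonic functions on $\mathbb H$; $|E|$ is the Lebesgue measure of $E$. $A\asymp B$ means $cA\le B\le CA$ for some constants $c,C>0$. For $0<p<\infty$, $\lambda>-1$, the weighted harmonic Bergman space $A(p,\lambda)$ consists of all $f\in h(\mathbb H)$ with $\|f\|_{A(p,\lambda)}=\left(\int_{\mathbb H}|f(x,t)|^pt^\lambda\,dx\,dt\right)^{1/p}<\infty$. For $k\in\mathbb Z$ set $H_k=\mathbb R^n\times[2^{-k-1},2^{-k})$. For a positive Borel measure $\mu$ on $\mathbb H$ and $0<p,q<\infty$, $K^p_q(\mu)$ is the space of $f\in h(\mathbb H)$ with $$\|f\|_{K^p_q(\mu)}^q=\sum_{k=-\infty}^\infty\left(\int_{H_k}|f(z)|^p\,d\mu(z)\right)^{q/p}<\infty.$$ $\{\Delta_j\}_{j\ge1}$ is a fixed Whitney decomposition of $\mathbb H$: closed cubes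 in $\mathbb H$ with sides parallel to the coordinate axes, with pairwise disjoint interiors, $\bigcup_j\Delta_j=\mathbb H$, and $\operatorname{diam}\Delta_j\asymp\operatorname{dist}(\Delta_j,\partial\mathbb H)$ uniformly in $j$. $\Delta_j^\ast$ is the cube with the same center $\zeta_j=(\xi_j,\eta_j)$ as $\Delta_j$ enlarged $5/4$ times; these satisfy $\Delta_j^\ast\subset\mathbb H$, $\sum_j\chi_{\Delta_j^\ast}\le C_n$, and $t\asymp\eta_j$ for $(x,t)\in\Delta_j^\ast$, uniformly in $j$. *)

theory Defs
  imports "HOL-Analysis.Analysis"
begin

definition partial_deriv :: "'a::euclidean_space \<Rightarrow> ('a \<Rightarrow> real) \<Rightarrow> 'a \<Rightarrow> real" where
  "partial_deriv b f x = frechet_derivative f (at x) b"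

definition laplacian :: "('a::euclidean_space \<Rightarrow> real) \<Rightarrow> 'a \<Rightarrow> real" where
  "laplacian f x = (\<Sum>b\<in>Basis. partial_deriv b (partial_deriv b f) x)"

definition C2_on :: "('a::euclidean_space \<Rightarrow> real) \<Rightarrow> 'a set \<Rightarrow> bool" where
  "C2_on f S \<longleftrightarrow>
     f differentiable_on S \<and>
     (\<forall>b\<in>Basis. partial_deriv b f differentiable_on S) \<and>
     (\<forall>b\<in>Basis. \<forall>c\<in>Basis. continuous_on S (partial_deriv c (partial_deriv b f)))"

(* Meant for open S only: the partial derivatives are taken in the full space. *)
definition harmonic_on :: "('a::euclidean_space \<Rightarrow> real) \<Rightarrow> 'a set \<Rightarrow> bool" where
  "harmonic_on f S \<longleftrightarrow> C2_on f S \<and> (\<forall>x\<in>S. laplacian f x = 0)"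

definition half_space :: "((real ^ 'n) \<times> real) set" where
  "half_space = {(x, t). 0 < t}"

(* Power of an extended nonnegative real with a positive real exponent. *)
definition epowr :: "ennreal \<Rightarrow> real \<Rightarrow> ennreal" where
  "epowr x a = (if x = \<infinity> then \<infinity> else ennreal (enn2real x powr a))"

(* Functions are total on the ambient space; only their values on half_space matter.
   The (quasi-)norms below take the value \<infinity> outside the respective spaces. *)
definition bergman_norm :: "real \<Rightarrow> real \<Rightarrow> ((real ^ 'n) \<times> real \<Rightarrow> real) \<Rightarrow> ennreal" where
  "bergman_norm p \<beta> f =
     epowr (\<integral>\<^sup>+z\<in>half_space. ennreal (\<bar>f z\<bar> powr p * snd z powr \<beta>) \<partial>lborel) (1 / p)"

definition bergman_space :: "real \<Rightarrow> real \<Rightarrow> ((real ^ 'n) \<times> real \<Rightarrow> real) set" where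
  "bergman_space p \<beta> = {f. harmonic_on f half_space \<and> bergman_norm p \<beta> f < \<infinity>}"

definition layer :: "int \<Rightarrow> ((real ^ 'n) \<times> real) set" where
  "layer k = UNIV \<times> {2 powi (- k - 1)..<2 powi (- k)}"

definition K_norm ::
  "((real ^ 'n) \<times> real) measure \<Rightarrow> real \<Rightarrow> real \<Rightarrow> ((real ^ 'n) \<times> real \<Rightarrow> real) \<Rightarrow> ennreal" where
  "K_norm \<mu> p q f =
     epowr (\<Sum>\<^sub>\<infinity>k::int. epowr (\<integral>\<^sup>+z\<in>layer k. ennreal (\<bar>f z\<bar> powr p) \<partial>\<mu>) (q / p)) (1 / q)"

definition K_space ::
  "((real ^ 'n) \<times> real) measure \<Rightarrow> real \<Rightarrow> real \<Rightarrow> ((real ^ 'n) \<times> real \<Rightarrow> real) set" where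
  "K_space \<mu> p q = {f. harmonic_on f half_space \<and> K_norm \<mu> p q f < \<infinity>}"

definition closed_cube :: "'a::euclidean_space set \<Rightarrow> bool" where
  "closed_cube Q \<longleftrightarrow> (\<exists>c r. 0 < r \<and> Q = cbox (c - r *\<^sub>R One) (c + r *\<^sub>R One))"

definition whitney_decomposition :: "(nat \<Rightarrow> ((real ^ 'n) \<times> real) set) \<Rightarrow> bool" where
  "whitney_decomposition \<Delta> \<longleftrightarrow>
     (\<forall>j. closed_cube (\<Delta> j) \<and> \<Delta> j \<subseteq> half_space) \<and>
     (\<forall>i j. i \<noteq> j \<longrightarrow> interior (\<Delta> i) \<inter> interior (\<Delta> j) = {}) \<and>
     (\<Union>j. \<Delta> j) = half_space \<and>
     (\<exists>c>0. \<exists>C>0. \<forall>j.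
        c * setdist (\<Delta> j) (frontier half_space) \<le> diameter (\<Delta> j) \<and>
        diameter (\<Delta> j) \<le> C * setdist (\<Delta> j) (frontier half_space))"

end

theory Submission
  imports Defs
begin

text \<open>
  Since \<open>q / p \<ge> 1\<close>, the sum over the layers is dominated by the power \<open>q / p\<close> of the full integral of
  \<open>|f|\<^sup>p\<close> against \<open>\<mu>\<close>. That integral is controlled cube by cube: \<open>|f|\<^sup>p\<close> has a sub-mean value property
  for every \<open>p > 0\<close>, and the neighbourhoods of the Whitney cubes on which the means are taken overlap
  boundedly, by comparing volumes.

  Conversely, the functions \<open>K(z - (\<xi>, -\<eta>))\<close>, where \<open>K\<close> is the Kelvin transform of a homogeneous harmonic
  polynomial of large degree, decay fast enough to have Bergman norm bounded by a power of \<open>\<eta>\<close> dictated by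
  homogeneity, and they are bounded below on a ball of radius \<open>\<epsilon> \<eta>\<close> about \<open>(\<xi>, \<eta>)\<close>. Such a ball meets only
  three layers, and boundedly many such balls cover a Whitney cube.
\<close>

section \<open>Weighted mean values of harmonic functions\<close>

text \<open>One homogeneity count governs both directions: |Delta_j| is comparable to eta_j^(n+1),
  so condition (2) says mu(Delta_j) <= C eta_j^(n+1+alpha), and the integral of |f|^p t^alpha scales
  with the same exponent. The sub-mean value property is obtained without surface measure: the means
  carry the weight (1 - |w|^2)_+, whose product with w is -1/4 times the gradient of the C^1
  function (1 - |w|^2)_+^2, so the radial derivative integrates to 0 over a cube with no boundary
  term. The degree m of the polynomial is the free parameter of the test functions: the p-th power
  of the kernel decays like |w|^(-(m+n-1)p), which for small p is integrable against t^alpha only if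
  m is large. The pole is the mirror image of the centre, at distance 2 eta from it, so translation
  and dilation reduce every test function to the one with pole (0, -1).\<close>

text \<open>\<open>V\<close> is supported in the cube of half-side 1, so its integral over the cube
  of half-side 2 does not change under shifts by \<open>s *\<^sub>R b\<close> with |s| < 1;
  differentiating this constant under the integral at s = 0 gives the claim. The margin between the
  two cubes replaces boundary terms.\<close>

lemma integral_directional_derivative_eq_0:
  fixes V V' :: "'a::euclidean_space \<Rightarrow> real"
  assumes b: "b \<in> Basis"
    and supp: "\<And>w. w \<notin> cbox (- One) One \<Longrightarrow> V w = 0"
    and contV: "continuous_on UNIV V"
    and deriv: "\<And>w. ((\<lambda>s. V (w + s *\<^sub>R b)) has_real_derivative V' w) (at 0)"
    and contV': "continuous_on UNIV V'"
  shows "integral (cbox (- (2 *\<^sub>R One)) (2 *\<^sub>R One)) V' = 0"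
proof -
  define Q :: "'a set" where "Q = cbox (- (2 *\<^sub>R One)) (2 *\<^sub>R One)"
  have deriv': "((\<lambda>s. V (w + s *\<^sub>R b)) has_real_derivative V' (w + s *\<^sub>R b)) (at s)" for w s
  proof -
    have "((\<lambda>h. V (w + (h + s) *\<^sub>R b)) has_real_derivative V' (w + s *\<^sub>R b)) (at 0)"
      using deriv[of "w + s *\<^sub>R b"] by (simp add: algebra_simps)
    then show ?thesis
      using DERIV_shift[of "\<lambda>s. V (w + s *\<^sub>R b)" "V' (w + s *\<^sub>R b)" 0 s] by simp
  qed
  have "((\<lambda>s. integral Q (\<lambda>w. V (w + s *\<^sub>R b))) has_real_derivative
      integral Q (\<lambda>w. V' (w + 0 *\<^sub>R b))) (at 0 within {-1..1})"
    unfolding Q_def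
  proof (rule leibniz_rule_field_derivative)
    show "continuous_on ({-1..1} \<times> cbox (- (2 *\<^sub>R One)) (2 *\<^sub>R One)) (\<lambda>(s, w). V' (w + s *\<^sub>R b))"
      unfolding split_beta
      by (rule continuous_on_compose2[OF contV']) (auto intro!: continuous_intros)
  next
    fix s :: real
    show "(\<lambda>w. V (w + s *\<^sub>R b)) integrable_on cbox (- (2 *\<^sub>R One)) (2 *\<^sub>R One)"
      by (intro integrable_continuous continuous_on_compose2[OF contV]) (auto intro!: continuous_intros)
  next
    fix s w
    show "((\<lambda>s. V (w + s *\<^sub>R b)) has_real_derivative V' (w + s *\<^sub>R b)) (at s within {-1..1})"
      by (rule has_field_derivative_at_within[OF deriv'])
  qed simp_all
  moreover have "at 0 within {-1..1} = at (0::real)"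
    by (rule at_within_interior) simp
  ultimately have D: "((\<lambda>s. integral Q (\<lambda>w. V (w + s *\<^sub>R b))) has_real_derivative integral Q V') (at 0)"
    by simp
  have const: "integral Q (\<lambda>w. V (w + s *\<^sub>R b)) = integral (cbox (- One) One) V" if s: "\<bar>s\<bar> < 1" for s
  proof -
    have "integral (cbox (- (2 *\<^sub>R One)) (2 *\<^sub>R One)) (\<lambda>w. V (w + s *\<^sub>R b))
        = integral (cbox (- (2 *\<^sub>R One) + s *\<^sub>R b) (2 *\<^sub>R One + s *\<^sub>R b)) V"
      using integral_shift_cbox_plus[of "- (2 *\<^sub>R One)" "2 *\<^sub>R One" V "s *\<^sub>R b"]
      by (simp add: o_def add.commute)
    also have "\<dots> = integral (cbox (- One) One) V"
    proof (rule integral_unique, rule has_integral_on_superset[OF integrable_integral])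
      show "V integrable_on cbox (- One) One"
        by (intro integrable_continuous continuous_on_subset[OF contV]) auto
      have "- 2 + s * (b \<bullet> i) \<le> - 1" "1 \<le> 2 + s * (b \<bullet> i)" if "i \<in> Basis" for i
        using that b s by (auto simp: inner_Basis)
      then show "cbox (- One) One \<subseteq> cbox (- (2 *\<^sub>R One) + s *\<^sub>R b) (2 *\<^sub>R One + s *\<^sub>R b)"
        by (intro subset_box_imp) (auto simp: inner_add_left inner_diff_left)
    qed (use supp in auto)
    finally show ?thesis by (simp add: Q_def)
  qed
  have "((\<lambda>s. integral Q (\<lambda>w. V (w + s *\<^sub>R b))) has_real_derivative 0) (at 0)"
  proof (rule has_field_derivative_transform_within_open[OF DERIV_const, of "{-1<..<1}"])
    show "integral (cbox (- One) One) V = integral Q (\<lambda>w. V (w + s *\<^sub>R b))" if "s \<in> {-1<..<1}" for s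
      using const[of s] that by auto
  qed auto
  with D show ?thesis unfolding Q_def by (rule DERIV_unique)
qed

text \<open>Squaring makes the positive part continuously differentiable: at 0 the difference
  quotient is \<open>max 0 h\<close>, which tends to 0.\<close>

lemma DERIV_max_0_power2:
  "((\<lambda>x::real. (max 0 x)\<^sup>2) has_real_derivative 2 * max 0 x) (at x)"
proof -
  consider "x < 0" | "x = 0" | "x > 0" by linarith
  then show ?thesis
  proof cases
    case 1
    then have "((\<lambda>_. 0) has_real_derivative 2 * max 0 x) (at x)" by simp
    then show ?thesis
      by (rule has_field_derivative_transform_within_open[of _ _ _ "{..<0}"]) (use 1 in auto)
  next
    case 2
    have "(\<lambda>h::real. (max 0 h)\<^sup>2 / h) = max 0"
      by (auto simp: fun_eq_iff max_def power2_eq_square)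
    moreover have "(max 0 \<longlongrightarrow> max 0 0) (at (0::real))"
      by (intro tendsto_intros)
    ultimately have "((\<lambda>h::real. (max 0 h)\<^sup>2 / h) \<longlongrightarrow> 0) (at 0)" by simp
    then show ?thesis using 2 by (simp add: DERIV_def)
  next
    case 3
    have "((\<lambda>x. x\<^sup>2) has_real_derivative 2 * max 0 x) (at x)"
      using 3 by (auto intro!: derivative_eq_intros)
    then show ?thesis
      by (rule has_field_derivative_transform_within_open[of _ _ _ "{0<..}"]) (use 3 in auto)
  qed
qed

text \<open>In gradient form: grad (\<phi>^2) = -4 \<phi> w for \<phi> = (1 - |w|^2)_+. This
  relation is what fits the weight \<phi> to radial derivatives.\<close>

lemma DERIV_bump:
  fixes w b :: "'a::euclidean_space"
  assumes "b \<in> Basis"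
  shows "((\<lambda>s. (max 0 (1 - (w + s *\<^sub>R b) \<bullet> (w + s *\<^sub>R b)))\<^sup>2) has_real_derivative
    - 4 * max 0 (1 - w \<bullet> w) * (w \<bullet> b)) (at 0)"
proof -
  have "((\<lambda>s. 1 - (w + s *\<^sub>R b) \<bullet> (w + s *\<^sub>R b)) has_real_derivative - 2 * (w \<bullet> b)) (at 0)"
    using assms by (auto simp: inner_simps inner_commute intro!: derivative_eq_intros)
  from DERIV_chain2[OF DERIV_max_0_power2 this] show ?thesis by (simp add: algebra_simps)
qed

text \<open>\<open>g\<close> is controlled only on the cube, so continuity is glued from two open
  sets: the open cube, and the complement of the closed unit ball, where the product is 0.\<close>

lemma continuous_on_mult_compact_support:
  fixes g h :: "'a::euclidean_space \<Rightarrow> real"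
  assumes g: "continuous_on (cbox (- (2 *\<^sub>R One)) (2 *\<^sub>R One)) g"
    and h: "continuous_on UNIV h" and supp: "\<And>w. norm w > 1 \<Longrightarrow> h w = 0"
  shows "continuous_on UNIV (\<lambda>w. h w * g w)"
proof -
  let ?B = "box (- (2 *\<^sub>R One)) (2 *\<^sub>R One) :: 'a set"
  have "continuous_on (?B \<union> - cball 0 1) (\<lambda>w. h w * g w)"
  proof (rule continuous_on_open_Un)
    show "continuous_on ?B (\<lambda>w. h w * g w)"
      by (intro continuous_intros continuous_on_subset[OF g] continuous_on_subset[OF h] box_subset_cbox) auto
    show "continuous_on (- cball 0 1) (\<lambda>w. h w * g w)"
      by (rule continuous_on_eq[OF continuous_on_const[of _ 0]]) (use supp in auto)
  qed auto
  moreover have "?B \<union> - cball 0 1 = UNIV"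
  proof -
    have "w \<in> ?B" if "norm w \<le> 1" for w
      using that Basis_le_norm[of _ w] by (fastforce simp: mem_box abs_le_iff)
    then show ?thesis by auto
  qed
  ultimately show ?thesis by simp
qed

lemma C2_onD:
  assumes "C2_on f S" "open S"
  shows "x \<in> S \<Longrightarrow> (f has_derivative frechet_derivative f (at x)) (at x)"
    and "x \<in> S \<Longrightarrow> b \<in> Basis \<Longrightarrow>
      (partial_deriv b f has_derivative frechet_derivative (partial_deriv b f) (at x)) (at x)"
    and "continuous_on S f"
    and "b \<in> Basis \<Longrightarrow> continuous_on S (partial_deriv b f)"
    and "b \<in> Basis \<Longrightarrow> c \<in> Basis \<Longrightarrow> continuous_on S (partial_deriv c (partial_deriv b f))"
  using assms unfolding C2_on_def
  by (auto simp: differentiable_on_eq_differentiable_at frechet_derivative_works[symmetric]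
      intro: differentiable_imp_continuous_on)

lemma frechet_derivative_eq_sum_partial_deriv:
  fixes f :: "'a::euclidean_space \<Rightarrow> real"
  assumes "(f has_derivative f') (at x)"
  shows "f' w = (\<Sum>b\<in>Basis. (w \<bullet> b) * partial_deriv b f x)"
proof -
  have lin: "linear f'" using assms by (rule has_derivative_linear)
  have eq: "frechet_derivative f (at x) = f'"
    using frechet_derivative_at[OF assms] by simp
  have "f' w = f' (\<Sum>b\<in>Basis. (w \<bullet> b) *\<^sub>R b)" by (simp add: euclidean_representation)
  also have "\<dots> = (\<Sum>b\<in>Basis. (w \<bullet> b) * f' b)"
    by (simp add: linear_sum[OF lin] linear_cmul[OF lin])
  finally show ?thesis by (simp add: partial_deriv_def eq)
qed

lemma DERIV_along_line:
  fixes g :: "'a::euclidean_space \<Rightarrow> real"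
  assumes "(g has_derivative g') (at (a + s *\<^sub>R v))"
  shows "((\<lambda>s. g (a + s *\<^sub>R v)) has_real_derivative g' v) (at s)"
proof -
  have "((\<lambda>s. g (a + s *\<^sub>R v)) has_derivative (\<lambda>h. g' (h *\<^sub>R v))) (at s)"
    by (rule has_derivative_compose[of "\<lambda>s. a + s *\<^sub>R v", OF _ assms]) (auto intro!: derivative_eq_intros)
  moreover have "(\<lambda>h. g' (h *\<^sub>R v)) = (*) (g' v)"
    using linear_cmul[OF has_derivative_linear[OF assms]] by auto
  ultimately show ?thesis by (simp add: has_field_derivative_def)
qed

text \<open>The integrand of the derivative in the radius is, up to a multiple of the Laplacian of \<open>f\<close>, the
  divergence of the compactly supported field \<open>- (1 - |w|\<^sup>2)\<^sub>+\<^sup>2 \<nabla>f(z + r w) / 4\<close>.\<close>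

lemma integral_radial_derivative_eq_0:
  fixes f :: "'a::euclidean_space \<Rightarrow> real"
  assumes harm: "harmonic_on f S" and S: "open S"
    and sub: "\<And>w. w \<in> cbox (- (2 *\<^sub>R One)) (2 *\<^sub>R One) \<Longrightarrow> z + r *\<^sub>R w \<in> S"
  shows "integral (cbox (- (2 *\<^sub>R One)) (2 *\<^sub>R One))
    (\<lambda>w. frechet_derivative f (at (z + r *\<^sub>R w)) w * max 0 (1 - w \<bullet> w)) = 0"
proof -
  have C2: "C2_on f S" and lap: "\<And>x. x \<in> S \<Longrightarrow> laplacian f x = 0"
    using harm by (auto simp: harmonic_on_def)
  note C2D = C2_onD[OF C2 S]
  let ?Q = "cbox (- (2 *\<^sub>R One)) (2 *\<^sub>R One) :: 'a set"
  define \<phi> where "\<phi> w = max 0 (1 - w \<bullet> w)" for w :: 'a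
  define p where "p b w = partial_deriv b f (z + r *\<^sub>R w)" for b w
  define pp where "pp b w = partial_deriv b (partial_deriv b f) (z + r *\<^sub>R w)" for b w
  define V where "V b w = (\<phi> w)\<^sup>2 * p b w" for b w
  define V' where "V' b w = (\<phi> w)\<^sup>2 * (r * pp b w) + (\<phi> w * (-4)) * ((w \<bullet> b) * p b w)" for b w
  have \<phi>0: "\<phi> w = 0" if "norm w \<ge> 1" for w
    using that by (simp add: \<phi>_def dot_square_norm)
  have cont\<phi>: "continuous_on UNIV \<phi>"
    unfolding \<phi>_def by (intro continuous_intros)
  have ball: "w \<in> ?Q" if "norm w \<le> 1" for w
    using that Basis_le_norm[of _ w] by (fastforce simp: mem_box abs_le_iff)
  have contp: "continuous_on ?Q (p b)" "continuous_on ?Q (pp b)" if "b \<in> Basis" for b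
    unfolding p_def pp_def using that sub
    by (auto intro!: continuous_on_compose2[OF C2D(4)] continuous_on_compose2[OF C2D(5)] continuous_intros)
  have contV': "continuous_on UNIV (V' b)" if "b \<in> Basis" for b
    unfolding V'_def using \<phi>0
    by (intro continuous_on_add continuous_on_mult_compact_support)
       (auto intro!: continuous_intros contp cont\<phi> that)
  have V'0: "integral ?Q (V' b) = 0" if b: "b \<in> Basis" for b
  proof (rule integral_directional_derivative_eq_0[OF b])
    show "continuous_on UNIV (V b)"
      unfolding V_def using \<phi>0
      by (intro continuous_on_mult_compact_support) (auto intro!: continuous_intros contp cont\<phi> b)
    show "V b w = 0" if "w \<notin> cbox (- One) One" for w
    proof -
      have "norm w > 1"
        using that Basis_le_norm[of _ w] by (fastforce simp: mem_box abs_le_iff not_less)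
      then show ?thesis by (simp add: V_def \<phi>0)
    qed
    show "continuous_on UNIV (V' b)" by (rule contV'[OF b])
    fix w
    show "((\<lambda>s. V b (w + s *\<^sub>R b)) has_real_derivative V' b w) (at 0)"
    \<comment> \<open>Outside the closed unit ball \<open>z + r *\<^sub>R w\<close> may leave
      \<open>S\<close>, where \<open>p b\<close> carries no information; but \<open>V b\<close>
      vanishes near such \<open>w\<close>. The sphere belongs to the first case, where the product
      rule still applies.\<close>
    proof (cases "norm w \<le> 1")
      case True
      have "((\<lambda>s. partial_deriv b f ((z + r *\<^sub>R w) + s *\<^sub>R (r *\<^sub>R b))) has_real_derivative
          frechet_derivative (partial_deriv b f) (at (z + r *\<^sub>R w)) (r *\<^sub>R b)) (at 0)"
        by (rule DERIV_along_line) (use C2D(2)[OF sub[OF ball[OF True]] b] in simp)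
      also have "frechet_derivative (partial_deriv b f) (at (z + r *\<^sub>R w)) (r *\<^sub>R b) = r * pp b w"
        using linear_cmul[OF has_derivative_linear[OF C2D(2)[OF sub[OF ball[OF True]] b]]]
        by (simp add: pp_def partial_deriv_def[of b "partial_deriv b f"])
      finally have "((\<lambda>s. p b (w + s *\<^sub>R b)) has_real_derivative r * pp b w) (at 0)"
        by (simp add: p_def algebra_simps)
      from DERIV_mult[OF DERIV_bump[OF b, of w] this] show ?thesis
        by (simp add: V_def V'_def \<phi>_def algebra_simps)
    next
      case False
      define T where "T = {s. norm (w + s *\<^sub>R b) > 1}"
      have "open T" unfolding T_def by (intro open_Collect_less continuous_intros)
      have "((\<lambda>s. V b (w + s *\<^sub>R b)) has_real_derivative 0) (at 0)"
        by (rule has_field_derivative_transform_within_open[OF DERIV_const[of 0] \<open>open T\<close>])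
           (use False in \<open>auto simp: T_def V_def \<phi>0\<close>)
      then show ?thesis using False by (simp add: V'_def \<phi>0)
    qed
  qed
  have "integral ?Q (\<lambda>w. frechet_derivative f (at (z + r *\<^sub>R w)) w * \<phi> w)
      = integral ?Q (\<lambda>w. (-1/4) * (\<Sum>b\<in>Basis. V' b w))"
  proof (rule integral_cong)
    fix w :: 'a assume "w \<in> ?Q"
    then have wS: "z + r *\<^sub>R w \<in> S" by (rule sub)
    have "(\<Sum>b\<in>Basis. pp b w) = 0"
      using lap[OF wS] by (simp add: laplacian_def pp_def)
    moreover have "(\<Sum>b\<in>Basis. V' b w) = (\<phi> w)\<^sup>2 * r * (\<Sum>b\<in>Basis. pp b w)
        - 4 * \<phi> w * (\<Sum>b\<in>Basis. (w \<bullet> b) * p b w)"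
      by (simp add: V'_def sum.distrib sum_distrib_left sum_distrib_right sum_subtractf sum_negf algebra_simps)
    ultimately show "frechet_derivative f (at (z + r *\<^sub>R w)) w * \<phi> w = (-1/4) * (\<Sum>b\<in>Basis. V' b w)"
      using frechet_derivative_eq_sum_partial_deriv[OF C2D(1)[OF wS], of w]
      by (simp add: p_def)
  qed
  also have "\<dots> = (-1/4) * (\<Sum>b\<in>Basis. integral ?Q (V' b))"
    by (subst integral_mult_right, subst integral_sum)
       (auto intro!: integrable_continuous continuous_on_subset[OF contV'])
  also have "\<dots> = 0" using V'0 by simp
  finally show ?thesis by (simp add: \<phi>_def)
qed

text \<open>The derivative of the weighted mean in the radius is 0 on [0, R], and at radius 0 the
  mean is \<open>f z\<close> times the mass of the weight. The whole scaled cube has to stay in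
  \<open>S\<close> because the integral is differentiated over the cube.\<close>

lemma harmonic_weighted_mean_value:
  fixes f :: "'a::euclidean_space \<Rightarrow> real"
  assumes harm: "harmonic_on f S" and S: "open S" and R: "0 \<le> R"
    and sub: "\<And>w r. w \<in> cbox (- (2 *\<^sub>R One)) (2 *\<^sub>R One) \<Longrightarrow> r \<in> {0..R} \<Longrightarrow> z + r *\<^sub>R w \<in> S"
  shows "integral (cbox (- (2 *\<^sub>R One)) (2 *\<^sub>R One)) (\<lambda>w. f (z + R *\<^sub>R w) * max 0 (1 - w \<bullet> w))
    = f z * integral (cbox (- (2 *\<^sub>R One)) (2 *\<^sub>R One)) (\<lambda>w::'a. max 0 (1 - w \<bullet> w))"
proof -
  have C2: "C2_on f S" using harm by (auto simp: harmonic_on_def)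
  note C2D = C2_onD[OF C2 S]
  let ?Q = "cbox (- (2 *\<^sub>R One)) (2 *\<^sub>R One) :: 'a set"
  define m where "m r = integral ?Q (\<lambda>w. f (z + r *\<^sub>R w) * max 0 (1 - w \<bullet> w))" for r
  have "(m has_real_derivative 0) (at r within {0..R})" if r: "r \<in> {0..R}" for r
  proof -
    have "(m has_real_derivative integral ?Q
        (\<lambda>w. frechet_derivative f (at (z + r *\<^sub>R w)) w * max 0 (1 - w \<bullet> w))) (at r within {0..R})"
      unfolding m_def
    proof (rule leibniz_rule_field_derivative[OF _ _ _ r])
      fix s w assume s: "s \<in> {0..R}" and w: "w \<in> ?Q"
      have "((\<lambda>s. f (z + s *\<^sub>R w)) has_real_derivative frechet_derivative f (at (z + s *\<^sub>R w)) w) (at s)"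
        by (intro DERIV_along_line C2D(1) sub s w)
      then show "((\<lambda>s. f (z + s *\<^sub>R w) * max 0 (1 - w \<bullet> w)) has_real_derivative
          frechet_derivative f (at (z + s *\<^sub>R w)) w * max 0 (1 - w \<bullet> w)) (at s within {0..R})"
        by (auto intro: has_field_derivative_at_within DERIV_cmult_right)
    next
      fix s assume s: "s \<in> {0..R}"
      show "(\<lambda>w. f (z + s *\<^sub>R w) * max 0 (1 - w \<bullet> w)) integrable_on ?Q"
        using s by (auto intro!: integrable_continuous continuous_intros continuous_on_compose2[OF C2D(3)] sub)
    next
      \<comment> \<open>Joint continuity of the directional derivative is read off its expansion in
        partial derivatives, which are the continuous objects supplied by
        \<open>C2_on\<close>.\<close>
      have "continuous_on ({0..R} \<times> ?Q)
         (\<lambda>x. (\<Sum>b\<in>Basis. (snd x \<bullet> b) * partial_deriv b f (z + fst x *\<^sub>R snd x)) * max 0 (1 - snd x \<bullet> snd x))"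
        by (auto intro!: continuous_intros continuous_on_compose2[OF C2D(4)] sub)
      then show "continuous_on ({0..R} \<times> ?Q)
         (\<lambda>(s, w). frechet_derivative f (at (z + s *\<^sub>R w)) w * max 0 (1 - w \<bullet> w))"
      proof (rule continuous_on_eq)
        fix x assume "x \<in> {0..R} \<times> ?Q"
        then have "z + fst x *\<^sub>R snd x \<in> S" by (auto intro!: sub)
        from frechet_derivative_eq_sum_partial_deriv[OF C2D(1)[OF this], of "snd x"]
        show "(\<Sum>b\<in>Basis. (snd x \<bullet> b) * partial_deriv b f (z + fst x *\<^sub>R snd x)) * max 0 (1 - snd x \<bullet> snd x)
          = (case x of (s, w) \<Rightarrow> frechet_derivative f (at (z + s *\<^sub>R w)) w * max 0 (1 - w \<bullet> w))"
          by (simp add: split_beta)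
      qed
    qed auto
    also have "integral ?Q (\<lambda>w. frechet_derivative f (at (z + r *\<^sub>R w)) w * max 0 (1 - w \<bullet> w)) = 0"
      using r by (intro integral_radial_derivative_eq_0[OF harm S] sub) auto
    finally show ?thesis .
  qed
  then obtain c where "\<And>r. r \<in> {0..R} \<Longrightarrow> m r = c"
    using has_field_derivative_zero_constant[of "{0..R}" m] by auto
  then have "m R = m 0" using R by simp
  then show ?thesis unfolding m_def by simp
qed

section \<open>The sub-mean value property of powers\<close>

lemma One_neq_0 [simp]: "(One :: 'a::euclidean_space) \<noteq> 0"
proof
  assume "(One :: 'a) = 0"
  then have "(One :: 'a) \<bullet> (SOME i. i \<in> Basis) = 0" by simp
  then show False by (simp add: SOME_Basis)
qed

lemma nn_integral_lborel_scale:
  fixes h :: "'a::euclidean_space \<Rightarrow> ennreal" and c :: real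
  assumes [measurable]: "h \<in> borel_measurable borel" and c: "c \<noteq> 0"
  shows "(\<integral>\<^sup>+w. h w \<partial>lborel) = ennreal (\<bar>c\<bar> ^ DIM('a)) * (\<integral>\<^sup>+w. h (t + c *\<^sub>R w) \<partial>lborel)"
  by (subst lborel_affine[OF c, of t])
     (simp add: nn_integral_density nn_integral_distr nn_integral_cmult)

lemma nn_set_integral_continuous_compact:
  fixes g :: "'a::euclidean_space \<Rightarrow> real"
  assumes K: "compact K" and g: "continuous_on K g" and nn: "\<And>x. x \<in> K \<Longrightarrow> 0 \<le> g x"
  shows "set_integrable lborel K g"
    and "(\<integral>\<^sup>+x\<in>K. ennreal (g x) \<partial>lborel) = ennreal (LINT x:K|lborel. g x)"
proof -
  show int: "set_integrable lborel K g"
    using borel_integrable_compact[OF K g] by (simp add: set_integrable_def)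
  have "(\<integral>\<^sup>+x\<in>K. ennreal (g x) \<partial>lborel) = (\<integral>\<^sup>+x. ennreal (indicator K x *\<^sub>R g x) \<partial>lborel)"
    by (intro nn_integral_cong) (auto simp: indicator_def)
  also have "\<dots> = ennreal (LINT x:K|lborel. g x)"
    unfolding set_lebesgue_integral_def
    using int nn by (intro nn_integral_eq_integral) (auto simp: set_integrable_def indicator_def)
  finally show "(\<integral>\<^sup>+x\<in>K. ennreal (g x) \<partial>lborel) = ennreal (LINT x:K|lborel. g x)" .
qed

lemma harmonic_on_continuous: "harmonic_on f S \<Longrightarrow> open S \<Longrightarrow> continuous_on S f"
  using C2_onD(3) by (auto simp: harmonic_on_def)

text \<open>The weight is at most 1 and \<open>D\<close> is the norm of a corner of the cube, so at
  scale \<open>R / D\<close> the cube lies in the ball of radius \<open>R\<close> and the weighted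
  mean is dominated by the plain one. The constant is D^d divided by the mass \<open>c\<close> of
  the weight.\<close>

lemma harmonic_abs_le_mean:
  obtains C :: real where "0 < C"
    and "\<And>(f :: 'a::euclidean_space \<Rightarrow> real) S z R. harmonic_on f S \<Longrightarrow> open S \<Longrightarrow> 0 < R \<Longrightarrow>
      cball z R \<subseteq> S \<Longrightarrow> \<bar>f z\<bar> \<le> C / R ^ DIM('a) * (LINT w:cball z R|lborel. \<bar>f w\<bar>)"
proof -
  let ?Q = "cbox (- (2 *\<^sub>R One)) (2 *\<^sub>R One) :: 'a set"
  define \<phi> where "\<phi> w = max 0 (1 - w \<bullet> w)" for w :: 'a
  define c where "c = integral ?Q \<phi>"
  define D where "D = 2 * norm (One :: 'a)"
  have D: "D > 0" unfolding D_def by simp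
  have cont\<phi>: "continuous_on A \<phi>" for A unfolding \<phi>_def by (intro continuous_intros)
  have \<phi>0: "\<phi> w = 0" if "norm w > 1" for w
    using that one_le_power[of "norm w" 2] by (simp add: \<phi>_def dot_square_norm)
  have \<phi>_nonneg: "0 \<le> \<phi> w" and \<phi>_le: "\<phi> w \<le> 1" for w by (auto simp: \<phi>_def)
  have "c \<ge> 0" unfolding c_def
    by (intro integral_nonneg integrable_continuous cont\<phi>) (simp add: \<phi>_nonneg)
  \<comment> \<open>A continuous nonnegative weight with integral 0 would vanish on the cube, but
    the weight is 1 at the origin.\<close>
  moreover have "c \<noteq> 0"
  proof
    assume "c = 0"
    then have "(\<phi> has_integral 0) ?Q"
      unfolding c_def by (metis integrable_integral integrable_continuous cont\<phi>)
    then have "\<phi> 0 = 0"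
      by (rule has_integral_0_cbox_imp_0[OF cont\<phi> \<phi>_nonneg])
         (auto simp: box_ne_empty mem_box inner_Basis)
    then show False by (simp add: \<phi>_def)
  qed
  ultimately have c: "c > 0" by simp
  show thesis
  proof (rule that[of "D ^ DIM('a) / c"])
    show "0 < D ^ DIM('a) / c" using D c by simp
    fix f :: "'a \<Rightarrow> real" and S z R
    assume harm: "harmonic_on f S" and S: "open S" and R: "0 < R" and sub: "cball z R \<subseteq> S"
    define r where "r = R / D"
    have r: "0 < r" using R D by (simp add: r_def)
    have contf: "continuous_on S f" by (rule harmonic_on_continuous[OF harm S])
    have normQ: "norm w \<le> D" if "w \<in> ?Q" for w
    proof -
      have "norm w \<le> norm (2 *\<^sub>R One :: 'a)"
        using that by (intro norm_le_componentwise) (auto simp: mem_box abs_le_iff)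
      then show ?thesis by (simp add: D_def)
    qed
    have inS: "z + s *\<^sub>R w \<in> cball z R" if "w \<in> ?Q" "s \<in> {0..r}" for w s
    proof -
      have "s * norm w \<le> r * D" using that normQ r by (intro mult_mono) auto
      then show ?thesis using that D by (simp add: dist_norm r_def)
    qed
    have int_eq: "integral ?Q (\<lambda>w. f (z + r *\<^sub>R w) * \<phi> w) = f z * c"
      unfolding \<phi>_def c_def
      by (rule harmonic_weighted_mean_value[OF harm S]) (use r inS sub in auto)
    have contfz: "continuous_on ?Q (\<lambda>w. f (z + r *\<^sub>R w))"
      by (intro continuous_on_compose2[OF contf] continuous_intros) (use inS sub r in auto)
    have "\<bar>f z\<bar> * c = norm (integral ?Q (\<lambda>w. f (z + r *\<^sub>R w) * \<phi> w))"
      using int_eq c by (simp add: abs_mult)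
    also have "\<dots> \<le> integral ?Q (\<lambda>w. \<bar>f (z + r *\<^sub>R w)\<bar> * \<phi> w)"
      by (intro integral_norm_bound_integral integrable_continuous continuous_intros contfz cont\<phi>)
         (auto simp: abs_mult \<phi>_nonneg)
    also have "\<dots> = (LINT w:?Q|lborel. \<bar>f (z + r *\<^sub>R w)\<bar> * \<phi> w)"
      by (intro set_borel_integral_eq_integral(2)[symmetric] nn_set_integral_continuous_compact)
         (auto intro!: continuous_intros contfz cont\<phi> simp: \<phi>_nonneg)
    finally have "ennreal (\<bar>f z\<bar> * c) \<le> ennreal (LINT w:?Q|lborel. \<bar>f (z + r *\<^sub>R w)\<bar> * \<phi> w)"
      by (rule ennreal_leI)
    also have "\<dots> = (\<integral>\<^sup>+w\<in>?Q. ennreal (\<bar>f (z + r *\<^sub>R w)\<bar> * \<phi> w) \<partial>lborel)"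
      by (intro nn_set_integral_continuous_compact(2)[symmetric])
         (auto intro!: continuous_intros contfz cont\<phi> simp: \<phi>_nonneg)
    also have "\<dots> \<le> (\<integral>\<^sup>+w. ennreal \<bar>f (z + r *\<^sub>R w)\<bar> * indicator (cball z R) (z + r *\<^sub>R w) \<partial>lborel)"
    proof (intro nn_integral_mono)
      fix w :: 'a
      show "ennreal (\<bar>f (z + r *\<^sub>R w)\<bar> * \<phi> w) * indicator ?Q w
        \<le> ennreal \<bar>f (z + r *\<^sub>R w)\<bar> * indicator (cball z R) (z + r *\<^sub>R w)"
        using inS[of w r] r \<phi>_le[of w] \<phi>_nonneg[of w]
        by (auto simp: indicator_def intro!: ennreal_leI mult_left_le)
    qed
    also have "\<dots> = ennreal (1 / r ^ DIM('a)) * (\<integral>\<^sup>+w\<in>cball z R. ennreal \<bar>f w\<bar> \<partial>lborel)"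
    proof -
      have meas: "(\<lambda>w. ennreal \<bar>f w\<bar> * indicator (cball z R) w) \<in> borel_measurable borel"
      proof -
        have "(\<lambda>w. ennreal (indicator (cball z R) w *\<^sub>R \<bar>f w\<bar>)) \<in> borel_measurable borel"
          by (intro measurable_compose[OF borel_measurable_continuous_on_indicator measurable_ennreal]
              continuous_intros continuous_on_subset[OF contf sub]) auto
        also have "(\<lambda>w. ennreal (indicator (cball z R) w *\<^sub>R \<bar>f w\<bar>)) = (\<lambda>w. ennreal \<bar>f w\<bar> * indicator (cball z R) w)"
          by (auto simp: indicator_def)
        finally show ?thesis .
      qed
      have "ennreal (1 / r ^ DIM('a)) * (ennreal (\<bar>r\<bar> ^ DIM('a)) * x) = x" for x
        using r by (simp add: mult.assoc[symmetric] ennreal_mult[symmetric])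
      then show ?thesis
        using nn_integral_lborel_scale[OF meas, of r z] r by simp
    qed
    also have "\<dots> = ennreal (1 / r ^ DIM('a) * (LINT w:cball z R|lborel. \<bar>f w\<bar>))"
    proof -
      have eq: "(\<integral>\<^sup>+w\<in>cball z R. ennreal \<bar>f w\<bar> \<partial>lborel) = ennreal (LINT w:cball z R|lborel. \<bar>f w\<bar>)"
        by (intro nn_set_integral_continuous_compact(2) continuous_intros continuous_on_subset[OF contf sub]) auto
      show ?thesis unfolding eq by (rule ennreal_mult'[symmetric]) (use r in simp)
    qed
    finally have "\<bar>f z\<bar> * c \<le> 1 / r ^ DIM('a) * (LINT w:cball z R|lborel. \<bar>f w\<bar>)"
      using r by (subst (asm) ennreal_le_iff)
        (auto intro!: mult_nonneg_nonneg integral_nonneg_AE simp: set_lebesgue_integral_def)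
    then show "\<bar>f z\<bar> \<le> D ^ DIM('a) / c / R ^ DIM('a) * (LINT w:cball z R|lborel. \<bar>f w\<bar>)"
      using c D R by (simp add: field_simps r_def power_divide)
  qed
qed

section \<open>From the mean of |f| to the mean of |f|^p\<close>

text \<open>Below \<open>l\<close> the first summand suffices; above it x = x^(1-p) x^p with 1 - p
  <= 0. The threshold \<open>l\<close> stays free, so that its contribution can later be
  absorbed.\<close>

lemma le_add_powr:
  fixes x l p :: real
  assumes "1 \<le> p" "0 \<le> x" "0 < l"
  shows "x \<le> l + l powr (1 - p) * x powr p"
proof (cases "x \<le> l")
  case True
  then show ?thesis using assms by (simp add: add_increasing2)
next
  case False
  have "x = x powr (1 - p) * x powr p" using False assms by (simp flip: powr_add)
  also have "\<dots> \<le> l powr (1 - p) * x powr p"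
    using False assms by (intro mult_right_mono powr_mono2') auto
  finally show ?thesis using assms by simp
qed

lemma continuous_on_abs_powr:
  fixes f :: "'a::topological_space \<Rightarrow> real"
  assumes "continuous_on S f" "0 < p"
  shows "continuous_on S (\<lambda>x. \<bar>f x\<bar> powr p)"
  using assms by (intro continuous_on_powr' continuous_intros) auto

text \<open>Splitting |f| at the threshold \<open>l\<close> costs C l M for the constant term; with
  \<open>l\<close> proportional to |f z| this is half the left side and is absorbed. What remains is
  l^(1-p) times the integral of |f|^p, and multiplying by l^(p-1) produces |f z|^p.\<close>

lemma mean_bound_imp_powr_mean_bound_ge1:
  fixes f :: "'a::euclidean_space \<Rightarrow> real"
  assumes p: "1 \<le> p" and C: "0 < C" and R: "0 < R" and cont: "continuous_on (cball z R) f"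
    and le: "\<bar>f z\<bar> \<le> C / R ^ DIM('a) * (LINT w:cball z R|lborel. \<bar>f w\<bar>)"
  defines "M \<equiv> unit_ball_vol (DIM('a))"
  shows "\<bar>f z\<bar> powr p \<le> 2 * C * (2 * C * M) powr (p - 1) / R ^ DIM('a)
      * (LINT w:cball z R|lborel. \<bar>f w\<bar> powr p)"
proof (cases "f z = 0")
  case True
  then show ?thesis
    using C R p by (auto intro!: mult_nonneg_nonneg divide_nonneg_nonneg integral_nonneg_AE
        simp: set_lebesgue_integral_def)
next
  case False
  have M: "measure lborel (cball z R) = R ^ DIM('a) * M" "M > 0"
    using R by (auto simp: M_def content_cball)
  define l where "l = \<bar>f z\<bar> / (2 * C * M)"
  have l: "l > 0" using C M False by (simp add: l_def)
  let ?I = "LINT w:cball z R|lborel. \<bar>f w\<bar> powr p"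
  have int: "set_integrable lborel (cball z R) (\<lambda>w. \<bar>f w\<bar> powr p)"
    using p by (intro nn_set_integral_continuous_compact continuous_on_abs_powr cont) auto
  have intc: "set_integrable lborel (cball z R) (\<lambda>w. l)"
    using l by (intro nn_set_integral_continuous_compact) auto
  have intf: "set_integrable lborel (cball z R) (\<lambda>w. \<bar>f w\<bar>)"
    by (intro nn_set_integral_continuous_compact continuous_intros cont) auto
  have "(LINT w:cball z R|lborel. \<bar>f w\<bar>)
      \<le> (LINT w:cball z R|lborel. l + l powr (1 - p) * \<bar>f w\<bar> powr p)"
    by (intro set_integral_mono set_integral_add intf intc set_integrable_mult_right impI int)
       (use p l in \<open>auto intro!: le_add_powr\<close>)
  also have "\<dots> = l * (R ^ DIM('a) * M) + l powr (1 - p) * ?I"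
  proof -
    have "(LINT w:cball z R|lborel. l) = l * (R ^ DIM('a) * M)"
      unfolding set_lebesgue_integral_def using M by (simp add: emeasure_lborel_cball_finite)
    then show ?thesis by (subst set_integral_add(2)) (auto intro!: intc int)
  qed
  finally have "C / R ^ DIM('a) * (LINT w:cball z R|lborel. \<bar>f w\<bar>)
      \<le> C / R ^ DIM('a) * (l * (R ^ DIM('a) * M) + l powr (1 - p) * ?I)"
    using C R by (intro mult_left_mono) auto
  with le have "\<bar>f z\<bar> \<le> C * l * M + C / R ^ DIM('a) * (l powr (1 - p) * ?I)"
    using R by (simp add: distrib_left)
  moreover have "C * l * M = \<bar>f z\<bar> / 2" using C M by (simp add: l_def)
  ultimately have "\<bar>f z\<bar> \<le> 2 * C / R ^ DIM('a) * (l powr (1 - p) * ?I)" by linarith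
  then have "l powr (p - 1) * \<bar>f z\<bar> \<le> l powr (p - 1) * (2 * C / R ^ DIM('a) * (l powr (1 - p) * ?I))"
    by (intro mult_left_mono) auto
  also have "\<dots> = (l powr (p - 1) * l powr (1 - p)) * (2 * C / R ^ DIM('a) * ?I)" by simp
  also have "l powr (p - 1) * l powr (1 - p) = 1" using l by (simp flip: powr_add)
  finally have "l powr (p - 1) * \<bar>f z\<bar> \<le> 2 * C / R ^ DIM('a) * ?I" by simp
  moreover have "\<bar>f z\<bar> powr p = (2 * C * M) powr (p - 1) * (l powr (p - 1) * \<bar>f z\<bar>)"
  proof -
    have "\<bar>f z\<bar> powr p = \<bar>f z\<bar> powr (p - 1) * \<bar>f z\<bar>"
      using False by (simp add: powr_diff)
    moreover have "\<bar>f z\<bar> = (2 * C * M) * l" using C M by (simp add: l_def)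
    moreover have "((2 * C * M) * l) powr (p - 1) = (2 * C * M) powr (p - 1) * l powr (p - 1)"
      by (rule powr_mult)
    ultimately show ?thesis by simp
  qed
  ultimately have "\<bar>f z\<bar> powr p \<le> (2 * C * M) powr (p - 1) * (2 * C / R ^ DIM('a) * ?I)"
    by (simp only: mult_left_mono powr_ge_zero)
  then show ?thesis by (simp add: algebra_simps)
qed

text \<open>The maximum over the ball of \<open>(R - |w - z|)\<^sup>d |f w|\<^sup>p\<close> is estimated at the point where it is
  attained, with \<open>|f| = |f|\<^sup>p |f|\<^bsup>1-p\<^esup>\<close> and the maximum itself bounding the second factor.\<close>

lemma mean_bound_imp_powr_mean_bound_less1:
  fixes f :: "'a::euclidean_space \<Rightarrow> real"
  assumes p: "0 < p" "p < 1" and C: "0 < C" and R: "0 < R" and cont: "continuous_on (cball z R) f"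
    and le: "\<And>w r. 0 < r \<Longrightarrow> cball w r \<subseteq> cball z R \<Longrightarrow>
      \<bar>f w\<bar> \<le> C / r ^ DIM('a) * (LINT w:cball w r|lborel. \<bar>f w\<bar>)"
  shows "\<bar>f z\<bar> powr p \<le> C * 2 powr (DIM('a) / p) / R ^ DIM('a)
      * (LINT w:cball z R|lborel. \<bar>f w\<bar> powr p)"
proof -
  define d where "d = DIM('a)"
  define g where "g w = (R - dist z w) ^ d * \<bar>f w\<bar> powr p" for w
  let ?I = "LINT w:cball z R|lborel. \<bar>f w\<bar> powr p"
  have I0: "?I \<ge> 0" by (auto intro!: integral_nonneg_AE simp: set_lebesgue_integral_def)
  have "continuous_on (cball z R) g"
    unfolding g_def using p by (intro continuous_intros continuous_on_abs_powr cont)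
  then obtain w0 where w0: "w0 \<in> cball z R" and max: "\<And>w. w \<in> cball z R \<Longrightarrow> g w \<le> g w0"
    using continuous_attains_sup[of "cball z R" g] R by auto
  define A where "A = g w0"
  have A: "R ^ d * \<bar>f z\<bar> powr p \<le> A" using max[of z] R by (simp add: A_def g_def)
  have "A \<le> C * 2 powr (d / p) * ?I"
  proof (cases "A \<le> 0")
    case True
    then show ?thesis using I0 C by (smt (verit) mult_nonneg_nonneg powr_ge_zero)
  next
    case False
    \<comment> \<open>Half the distance from \<open>w0\<close> to the sphere: on
      \<open>cball w0 r\<close> the weight is still at least r^d, while at \<open>w0\<close> itself
      it is (2r)^d. The two differ by the fixed factor 2^d, so \<open>B\<close> bounds |f|^p on the
      small ball and is comparable to it at \<open>w0\<close>.\<close>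
    define r where "r = (R - dist z w0) / 2"
    have r: "r > 0"
    proof -
      have "R - dist z w0 \<noteq> 0" using False unfolding A_def g_def d_def by (auto simp: zero_power)
      then show ?thesis using w0 by (simp add: r_def)
    qed
    have near: "R - dist z w \<ge> r" if "w \<in> cball w0 r" for w
      using that dist_triangle[of z w w0] by (auto simp: r_def field_simps)
    have sub: "cball w0 r \<subseteq> cball z R" using near r by fastforce
    define B where "B = A / r ^ d"
    have B: "B > 0" using False r by (simp add: B_def)
    have fle: "\<bar>f w\<bar> powr p \<le> B" if "w \<in> cball w0 r" for w
    proof -
      have "r ^ d * \<bar>f w\<bar> powr p \<le> g w"
        unfolding g_def using near[OF that] r by (intro mult_right_mono power_mono) auto
      also have "\<dots> \<le> A" using max sub that by (auto simp: A_def)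
      finally show ?thesis using r by (simp add: B_def field_simps)
    qed
    have fle': "\<bar>f w\<bar> \<le> B powr (1 / p - 1) * \<bar>f w\<bar> powr p" if "w \<in> cball w0 r" for w
    proof -
      have "\<bar>f w\<bar> = (\<bar>f w\<bar> powr p) powr (1 / p - 1) * \<bar>f w\<bar> powr p"
        using p by (simp add: powr_powr algebra_simps flip: powr_add)
      also have "\<dots> \<le> B powr (1 / p - 1) * \<bar>f w\<bar> powr p"
        using fle[OF that] p by (intro mult_right_mono powr_mono2) auto
      finally show ?thesis .
    qed
    have int: "set_integrable lborel (cball z R) (\<lambda>w. \<bar>f w\<bar> powr p)"
      using p by (intro nn_set_integral_continuous_compact continuous_on_abs_powr cont) auto
    have int': "set_integrable lborel (cball w0 r) (\<lambda>w. \<bar>f w\<bar> powr p)"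
      by (rule set_integrable_subset[OF int _ sub]) auto
    have intf: "set_integrable lborel (cball w0 r) (\<lambda>w. \<bar>f w\<bar>)"
      by (intro nn_set_integral_continuous_compact continuous_intros continuous_on_subset[OF cont sub]) auto
    have "(LINT w:cball w0 r|lborel. \<bar>f w\<bar>) \<le> (LINT w:cball w0 r|lborel. B powr (1 / p - 1) * \<bar>f w\<bar> powr p)"
      by (intro set_integral_mono intf set_integrable_mult_right impI int' fle')
    also have "\<dots> = B powr (1 / p - 1) * (LINT w:cball w0 r|lborel. \<bar>f w\<bar> powr p)" by simp
    also have "\<dots> \<le> B powr (1 / p - 1) * ?I"
      using sub int int' unfolding set_lebesgue_integral_def set_integrable_def
      by (intro mult_left_mono integral_mono) (auto simp: indicator_def)
    finally have "(LINT w:cball w0 r|lborel. \<bar>f w\<bar>) \<le> B powr (1 / p - 1) * ?I" .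
    then have "C / r ^ d * (LINT w:cball w0 r|lborel. \<bar>f w\<bar>) \<le> C / r ^ d * (B powr (1 / p - 1) * ?I)"
      using C r by (intro mult_left_mono) auto
    with le[OF r sub] have fw0: "\<bar>f w0\<bar> \<le> C / r ^ d * (B powr (1 / p - 1) * ?I)"
      by (simp add: d_def)
    have "\<bar>f w0\<bar> powr p = B / 2 powr d"
      using r by (simp add: B_def A_def g_def r_def power_divide powr_realpow field_simps)
    then have "\<bar>f w0\<bar> = (B / 2 powr d) powr (1 / p)"
      using p by (metis abs_ge_zero mult.right_neutral nonzero_mult_div_cancel_left
          order_less_irrefl powr_one powr_powr times_divide_eq_right)
    also have "\<dots> = B powr (1 / p - 1) * B / 2 powr (d / p)"
      using B by (simp add: powr_divide powr_powr powr_diff)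
    finally have "B powr (1 / p - 1) * B = 2 powr (d / p) * \<bar>f w0\<bar>"
      by (simp add: field_simps)
    also have "\<dots> \<le> 2 powr (d / p) * (C / r ^ d * (B powr (1 / p - 1) * ?I))"
      using fw0 by (intro mult_left_mono) auto
    finally have "B powr (1 / p - 1) * B \<le> 2 powr (d / p) * (C / r ^ d * (B powr (1 / p - 1) * ?I))" .
    then have "B powr (1 / p - 1) * B \<le> B powr (1 / p - 1) * (2 powr (d / p) * C / r ^ d * ?I)"
      by (simp add: algebra_simps)
    \<comment> \<open>Dividing by B^(1/p - 1) leaves the first power of \<open>B\<close>, that is A
      / r^d, and the uncontrolled radius \<open>r\<close> drops out.\<close>
    then have "B \<le> 2 powr (d / p) * C / r ^ d * ?I"
      using B by (simp only: mult_le_cancel_left_pos powr_gt_zero)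
    then show ?thesis using r by (simp add: B_def field_simps)
  qed
  with A have "R ^ d * \<bar>f z\<bar> powr p \<le> C * 2 powr (d / p) * ?I" by linarith
  then show ?thesis using R by (simp add: d_def field_simps)
qed

text \<open>The case p < 1 draws on the mean inequality for all balls inside the given one, so the
  constant of that inequality has to be uniform in the ball; the same uniformity in function, open
  set and ball is passed on.\<close>

lemma harmonic_powr_le_mean:
  fixes p :: real
  assumes p: "0 < p"
  obtains C :: real where "0 < C"
    and "\<And>(f :: 'a::euclidean_space \<Rightarrow> real) S z R. harmonic_on f S \<Longrightarrow> open S \<Longrightarrow> 0 < R \<Longrightarrow>
      cball z R \<subseteq> S \<Longrightarrow> ennreal (\<bar>f z\<bar> powr p)
        \<le> ennreal (C / R ^ DIM('a)) * (\<integral>\<^sup>+w\<in>cball z R. ennreal (\<bar>f w\<bar> powr p) \<partial>lborel)"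
proof -
  obtain C :: real where C: "0 < C" and mean:
    "\<And>(f :: 'a \<Rightarrow> real) S z R. harmonic_on f S \<Longrightarrow> open S \<Longrightarrow> 0 < R \<Longrightarrow>
      cball z R \<subseteq> S \<Longrightarrow> \<bar>f z\<bar> \<le> C / R ^ DIM('a) * (LINT w:cball z R|lborel. \<bar>f w\<bar>)"
    using harmonic_abs_le_mean by metis
  define M where "M = unit_ball_vol (DIM('a))"
  have M: "M > 0" by (simp add: M_def)
  define C' where "C' = (if p \<ge> 1 then 2 * C * (2 * C * M) powr (p - 1) else C * 2 powr (DIM('a) / p))"
  show thesis
  proof (rule that[of C'])
    show "0 < C'" using C M by (simp add: C'_def)
    fix f :: "'a \<Rightarrow> real" and S z R
    assume harm: "harmonic_on f S" and S: "open S" and R: "0 < R" and sub: "cball z R \<subseteq> S"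
    have cont: "continuous_on (cball z R) f"
      using harmonic_on_continuous[OF harm S] sub by (rule continuous_on_subset)
    have "\<bar>f z\<bar> powr p \<le> C' / R ^ DIM('a) * (LINT w:cball z R|lborel. \<bar>f w\<bar> powr p)"
    proof (cases "p \<ge> 1")
      case True
      then show ?thesis
        using mean_bound_imp_powr_mean_bound_ge1[OF True C R cont mean[OF harm S R sub]]
        by (simp add: C'_def M_def)
    next
      case False
      then show ?thesis
        using mean_bound_imp_powr_mean_bound_less1[OF p _ C R cont] mean[OF harm S] sub
        by (simp add: C'_def)
    qed
    then have "ennreal (\<bar>f z\<bar> powr p) \<le> ennreal (C' / R ^ DIM('a) * (LINT w:cball z R|lborel. \<bar>f w\<bar> powr p))"
      by (rule ennreal_leI)
    also have "\<dots> = ennreal (C' / R ^ DIM('a)) * (\<integral>\<^sup>+w\<in>cball z R. ennreal (\<bar>f w\<bar> powr p) \<partial>lborel)"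
    proof -
      have eq: "(\<integral>\<^sup>+w\<in>cball z R. ennreal (\<bar>f w\<bar> powr p) \<partial>lborel)
          = ennreal (LINT w:cball z R|lborel. \<bar>f w\<bar> powr p)"
        by (intro nn_set_integral_continuous_compact(2) continuous_on_abs_powr cont p) auto
      show ?thesis unfolding eq by (rule ennreal_mult') (use \<open>0 < C'\<close> R in simp)
    qed
    finally show "ennreal (\<bar>f z\<bar> powr p)
        \<le> ennreal (C' / R ^ DIM('a)) * (\<integral>\<^sup>+w\<in>cball z R. ennreal (\<bar>f w\<bar> powr p) \<partial>lborel)" .
  qed
qed

section \<open>Whitney cubes\<close>

lemma open_half_space: "open (half_space :: ((real ^ 'n) \<times> real) set)"
proof -
  have "(half_space :: ((real ^ 'n) \<times> real) set) = {z. 0 < snd z}"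
    by (auto simp: half_space_def)
  moreover have "open {z :: (real ^ 'n) \<times> real. 0 < snd z}"
    by (intro open_Collect_less continuous_intros)
  ultimately show ?thesis by simp
qed

lemma mem_half_space: "z \<in> half_space \<longleftrightarrow> 0 < snd z"
  by (auto simp: half_space_def)

lemma frontier_half_space: "frontier (half_space :: ((real ^ 'n) \<times> real) set) = {z. snd z = 0}"
proof -
  have "(half_space :: ((real ^ 'n) \<times> real) set) = {z. (0, 1) \<bullet> z > 0}"
    by (auto simp: half_space_def inner_prod_def)
  then show ?thesis
    using frontier_halfspace_gt[of "(0, 1) :: (real ^ 'n) \<times> real" 0]
    by (simp add: inner_prod_def prod_eq_iff)
qed

text \<open>The closed ball of the sup norm: \<open>r\<close> is half the side length.\<close>

definition cube :: "'a::euclidean_space \<Rightarrow> real \<Rightarrow> 'a set" where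
  "cube c r = cbox (c - r *\<^sub>R One) (c + r *\<^sub>R One)"

lemma mem_cube: "w \<in> cube c r \<longleftrightarrow> (\<forall>b\<in>Basis. \<bar>(w - c) \<bullet> b\<bar> \<le> r)"
  unfolding cube_def mem_box by (intro ball_cong) (auto simp: inner_simps)

lemma cube_norm_le:
  fixes w c :: "'a::euclidean_space"
  assumes w: "w \<in> cube c r"
  shows "norm (w - c) \<le> r * norm (One :: 'a)"
proof -
  have r: "r \<ge> 0" using w SOME_Basis by (force simp: mem_cube)
  have "norm (w - c) \<le> norm (r *\<^sub>R (One :: 'a))"
    using w r by (intro norm_le_componentwise) (auto simp: mem_cube)
  then show ?thesis using r by simp
qed

lemma cball_subset_cube: "cball c r \<subseteq> cube c r"
proof
  fix w assume "w \<in> cball c r"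
  then have "norm (w - c) \<le> r" by (simp add: dist_norm norm_minus_commute)
  then show "w \<in> cube c r" using Basis_le_norm[of _ "w - c"] by (force simp: mem_cube)
qed

lemma cube_snd:
  assumes "w \<in> cube c r"
  shows "\<bar>snd w - snd c\<bar> \<le> r"
proof -
  have "(0, 1) \<in> (Basis :: ('a \<times> real) set)" by (auto simp: Basis_prod_def)
  then show ?thesis using assms by (auto simp: mem_cube inner_prod_def dest!: bspec)
qed

lemma measure_cube: "0 \<le> r \<Longrightarrow> measure lborel (cube (c :: 'a::euclidean_space) r) = (2 * r) ^ DIM('a)"
  unfolding cube_def by (subst content_cbox') (auto simp: box_ne_empty inner_simps)

lemma emeasure_interior_cube:
  "0 \<le> r \<Longrightarrow> emeasure lborel (interior (cube (c :: 'a::euclidean_space) r)) = ennreal ((2 * r) ^ DIM('a))"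
  unfolding cube_def by (simp add: interior_cbox emeasure_lborel_box inner_simps)

text \<open>With \<open>D\<close> the norm of \<open>One\<close>, the diameter is 2 r D and the
  distance to the boundary is exactly \<open>snd (c j) - r j\<close>, so the Whitney condition
  becomes a pair of linear inequalities between half-side and height. They make half-side and
  clearance comparable to the height, with one constant for all cubes.\<close>

lemma whitney_cubes:
  fixes \<Delta> :: "nat \<Rightarrow> ((real ^ 'n) \<times> real) set"
  assumes W: "whitney_decomposition \<Delta>"
  obtains \<kappa> c r where "0 < \<kappa>" "\<kappa> \<le> 1"
    "\<And>j. \<Delta> j = cube (c j) (r j)" "\<And>j. 0 < snd (c j)" "\<And>j. \<kappa> * snd (c j) \<le> r j"
    "\<And>j. r j \<le> snd (c j)" "\<And>j. \<kappa> * snd (c j) \<le> snd (c j) - r j"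
proof -
  have "\<forall>j. \<exists>cr. 0 < snd cr \<and> \<Delta> j = cube (fst cr) (snd cr)"
    using W by (auto simp: whitney_decomposition_def closed_cube_def cube_def)
  then obtain cr where cr: "\<And>j. 0 < snd (cr j) \<and> \<Delta> j = cube (fst (cr j)) (snd (cr j))" by metis
  define c r where "c j = fst (cr j)" and "r j = snd (cr j)" for j
  have r: "0 < r j" and \<Delta>: "\<Delta> j = cube (c j) (r j)" for j using cr by (auto simp: c_def r_def)
  obtain k K where k: "k > 0" "K > 0"
    and kd: "\<And>j. k * setdist (\<Delta> j) (frontier half_space) \<le> diameter (\<Delta> j)"
    and Kd: "\<And>j. diameter (\<Delta> j) \<le> K * setdist (\<Delta> j) (frontier half_space)"
    using W unfolding whitney_decomposition_def by auto
  define D where "D = norm (One :: (real ^ 'n) \<times> real)"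
  have D: "D > 0" by (simp add: D_def)
  have diam: "diameter (\<Delta> j) = 2 * r j * D" for j
  proof -
    have "diameter (\<Delta> j) = dist (c j - r j *\<^sub>R One) (c j + r j *\<^sub>R One)"
      unfolding \<Delta> cube_def using r[of j] by (intro diameter_cbox) (auto simp: inner_simps)
    also have "\<dots> = norm (- (2 * r j) *\<^sub>R (One :: (real ^ 'n) \<times> real))"
    proof -
      have "(c j - r j *\<^sub>R One) - (c j + r j *\<^sub>R One) = - (2 * r j) *\<^sub>R (One :: (real ^ 'n) \<times> real)"
        by (rule euclidean_eqI) (simp add: inner_simps)
      then show ?thesis by (simp only: dist_norm)
    qed
    also have "\<dots> = 2 * r j * D" unfolding norm_scaleR D_def using r[of j] by simp
    finally show ?thesis .
  qed
  \<comment> \<open>The midpoint of the bottom face is a point of the cube closest to the boundary;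
    its membership in the open half space also gives \<open>r j < snd (c j)\<close>.\<close>
  have bottom: "c j - r j *\<^sub>R (0, 1) \<in> \<Delta> j" for j
    using r[of j] by (auto simp: \<Delta> mem_cube Basis_prod_def inner_prod_def)
  have pos: "snd (c j) - r j > 0" for j
  proof -
    have "c j - r j *\<^sub>R (0, 1) \<in> half_space"
      using W bottom[of j] unfolding whitney_decomposition_def by blast
    then show ?thesis by (simp add: mem_half_space)
  qed
  have setdist: "setdist (\<Delta> j) (frontier half_space) = snd (c j) - r j" for j
  proof (rule antisym)
    have "setdist (\<Delta> j) (frontier half_space) \<le> dist (c j - r j *\<^sub>R (0, 1)) (fst (c j), 0)"
      using bottom by (intro setdist_le_dist) (auto simp: frontier_half_space)
    also have "\<dots> = snd (c j) - r j"
      using pos[of j] by (simp add: dist_prod_def dist_real_def)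
    finally show "setdist (\<Delta> j) (frontier half_space) \<le> snd (c j) - r j" .
    show "snd (c j) - r j \<le> setdist (\<Delta> j) (frontier half_space)"
    proof (rule le_setdistI)
      show "\<Delta> j \<noteq> {}" using bottom by blast
      show "frontier half_space \<noteq> {}" by (auto simp: frontier_half_space intro!: exI[of _ "(0, 0)"])
      fix x y :: "(real ^ 'n) \<times> real"
      assume x: "x \<in> \<Delta> j" and y: "y \<in> frontier half_space"
      have "snd (c j) - r j \<le> \<bar>snd x - snd y\<bar>"
        using cube_snd[of x "c j" "r j"] x y by (auto simp: \<Delta> frontier_half_space)
      also have "\<dots> \<le> dist x y" using dist_snd_le[of x y] by (simp add: dist_real_def)
      finally show "snd (c j) - r j \<le> dist x y" .
    qed
  qed
  \<comment> \<open>With h the height of the centre, k (h - r) <= 2 r D solved for r / h gives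
    \<open>\<kappa>1\<close>; inserting r >= \<kappa>1 h into 2 r D <= K (h - r) gives
    \<open>\<kappa>2\<close>.\<close>
  define \<kappa>1 where "\<kappa>1 = k / (k + 2 * D)"
  define \<kappa>2 where "\<kappa>2 = 2 * D / K * \<kappa>1"
  define \<kappa> where "\<kappa> = min 1 (min \<kappa>1 \<kappa>2)"
  have \<kappa>: "0 < \<kappa>1" "0 < \<kappa>2" using k D by (auto simp: \<kappa>1_def \<kappa>2_def)
  have \<eta>: "0 < snd (c j)" "r j \<le> snd (c j)" for j using pos[of j] r[of j] by linarith+
  have 1: "\<kappa>1 * snd (c j) \<le> r j" for j
  proof -
    have "k * (snd (c j) - r j) \<le> 2 * r j * D" using kd[of j] by (simp add: diam setdist)
    then have "k * snd (c j) \<le> r j * (k + 2 * D)" by (simp add: algebra_simps)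
    then show ?thesis using k D by (simp add: \<kappa>1_def field_simps)
  qed
  have 2: "\<kappa>2 * snd (c j) \<le> snd (c j) - r j" for j
  proof -
    have "\<kappa>2 * snd (c j) = 2 * D / K * (\<kappa>1 * snd (c j))" by (simp add: \<kappa>2_def)
    also have "\<dots> \<le> 2 * D / K * r j" using 1[of j] k D by (intro mult_left_mono) auto
    also have "\<dots> \<le> snd (c j) - r j"
      using Kd[of j] k by (simp add: diam setdist field_simps)
    finally show ?thesis .
  qed
  show thesis
  proof (rule that[of \<kappa> c r])
    fix j
    have "\<kappa> * snd (c j) \<le> \<kappa>1 * snd (c j)" "\<kappa> * snd (c j) \<le> \<kappa>2 * snd (c j)"
      using \<eta>[of j] by (auto intro!: mult_right_mono simp: \<kappa>_def)
    then show "\<kappa> * snd (c j) \<le> r j" "\<kappa> * snd (c j) \<le> snd (c j) - r j"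
      using 1[of j] 2[of j] by linarith+
  qed (use \<kappa> \<Delta> \<eta> in \<open>auto simp: \<kappa>_def\<close>)
qed

section \<open>Bounded overlap and the estimate cube by cube\<close>

text \<open>Volume comparison: disjoint interiors of volume at least (2 \<rho>)^d inside a cube of
  volume (2 M)^d.\<close>

lemma card_disjoint_cubes_le:
  fixes c :: "'i \<Rightarrow> 'a::euclidean_space"
  assumes F: "finite F" and \<rho>: "0 < \<rho>" and M: "0 \<le> M" and r: "\<And>j. j \<in> F \<Longrightarrow> \<rho> \<le> r j"
    and sub: "\<And>j. j \<in> F \<Longrightarrow> cube (c j) (r j) \<subseteq> cube w M"
    and disj: "\<And>i j. i \<in> F \<Longrightarrow> j \<in> F \<Longrightarrow> i \<noteq> j \<Longrightarrow>
      interior (cube (c i) (r i)) \<inter> interior (cube (c j) (r j)) = {}"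
  shows "real (card F) \<le> (M / \<rho>) ^ DIM('a)"
proof -
  have "ennreal (card F * (2 * \<rho>) ^ DIM('a)) = (\<Sum>j\<in>F. ennreal ((2 * \<rho>) ^ DIM('a)))"
    using \<rho> by (simp add: ennreal_mult' ennreal_of_nat_eq_real_of_nat)
  also have "\<dots> \<le> (\<Sum>j\<in>F. emeasure lborel (interior (cube (c j) (r j))))"
  proof (rule sum_mono)
    fix j assume "j \<in> F"
    from r[OF this] \<rho> show "ennreal ((2 * \<rho>) ^ DIM('a)) \<le> emeasure lborel (interior (cube (c j) (r j)))"
      by (subst emeasure_interior_cube) (auto intro!: ennreal_leI power_mono)
  qed
  also have "\<dots> = emeasure lborel (\<Union>j\<in>F. interior (cube (c j) (r j)))"
    using disj F by (intro sum_emeasure) (auto simp: disjoint_family_on_def)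
  also have "\<dots> \<le> emeasure lborel (cube w M)"
    using sub interior_subset by (intro emeasure_mono) (fastforce simp: cube_def)+
  also have "\<dots> = ennreal ((2 * M) ^ DIM('a))"
    using M unfolding cube_def by (simp add: emeasure_lborel_cbox inner_simps)
  finally have "card F * (2 * \<rho>) ^ DIM('a) \<le> (2 * M) ^ DIM('a)"
    using M by (simp add: ennreal_le_iff)
  then have "card F * \<rho> ^ DIM('a) \<le> M ^ DIM('a)" by (simp add: power_mult_distrib)
  then show ?thesis using \<rho> by (simp add: power_divide field_simps)
qed

text \<open>The power is monotone in \<open>s\<close>, and the sign of \<alpha> decides the
  direction; the minimum over both ends of the interval covers the two signs at once.\<close>

lemma powr_ge_min_of_ratio:
  fixes a b s \<eta> \<alpha> :: real
  assumes "0 < a" "0 < \<eta>" "a * \<eta> \<le> s" "s \<le> b * \<eta>"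
  shows "min (a powr \<alpha>) (b powr \<alpha>) * \<eta> powr \<alpha> \<le> s powr \<alpha>"
proof -
  have s: "0 < s" using assms by (meson less_le_trans mult_pos_pos)
  then have b: "0 < b" using assms by (smt (verit) zero_less_mult_pos2)
  show ?thesis
  proof (cases "\<alpha> \<ge> 0")
    case True
    have "min (a powr \<alpha>) (b powr \<alpha>) * \<eta> powr \<alpha> \<le> a powr \<alpha> * \<eta> powr \<alpha>"
      by (intro mult_right_mono) auto
    also have "\<dots> = (a * \<eta>) powr \<alpha>" by (rule powr_mult[symmetric])
    also have "\<dots> \<le> s powr \<alpha>" using assms True by (intro powr_mono2) auto
    finally show ?thesis .
  next
    case False
    have "min (a powr \<alpha>) (b powr \<alpha>) * \<eta> powr \<alpha> \<le> b powr \<alpha> * \<eta> powr \<alpha>"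
      by (intro mult_right_mono) auto
    also have "\<dots> = (b * \<eta>) powr \<alpha>" by (rule powr_mult[symmetric])
    also have "\<dots> \<le> s powr \<alpha>" using assms s False by (intro powr_mono2') auto
    finally show ?thesis .
  qed
qed

lemma borel_measurable_half_space_restrict:
  fixes \<mu> :: "((real ^ 'n) \<times> real) measure" and g :: "(real ^ 'n) \<times> real \<Rightarrow> real"
  assumes \<mu>: "sets \<mu> = sets (restrict_space borel half_space)" and g: "continuous_on half_space g"
  shows "g \<in> borel_measurable \<mu>"
  using borel_measurable_continuous_on_restrict[OF g] measurable_cong_sets[OF \<mu> refl] by blast

lemma sets_half_space_restrict:
  fixes \<mu> :: "((real ^ 'n) \<times> real) measure"
  assumes \<mu>: "sets \<mu> = sets (restrict_space borel half_space)"
  shows "A \<in> sets \<mu> \<longleftrightarrow> A \<subseteq> half_space \<and> A \<in> sets borel"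
  unfolding \<mu> using borel_open[OF open_half_space] by (subst sets_restrict_space_iff) auto

text \<open>On a ball of radius \<kappa> \<eta>_j / 2 about a point of the cube the height is
  comparable to \<eta>_j, so the factor t^\<alpha> enters the sub-mean value inequality at the price
  of \<eta>_j^(-\<alpha>). Together with the volume of the ball, of order \<eta>_j^(n+1), this is
  exactly what the bound on \<mu> of the cube compensates.\<close>

lemma whitney_embedding:
  fixes \<mu> :: "((real ^ 'n) \<times> real) measure" and \<Delta> :: "nat \<Rightarrow> ((real ^ 'n) \<times> real) set"
  assumes p: "0 < p" and \<alpha>: "-1 < \<alpha>" and \<mu>: "sets \<mu> = sets (restrict_space borel half_space)"
    and W: "whitney_decomposition \<Delta>" and K: "0 < K"
    and le: "\<And>j. emeasure \<mu> (\<Delta> j) \<le> ennreal (K * measure lborel (\<Delta> j) powr (1 + \<alpha> / (real CARD('n) + 1)))"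
  obtains C where "0 < C" "\<And>f. harmonic_on f half_space \<Longrightarrow>
    (\<integral>\<^sup>+z\<in>half_space. ennreal (\<bar>f z\<bar> powr p) \<partial>\<mu>)
      \<le> ennreal C * (\<integral>\<^sup>+z\<in>half_space. ennreal (\<bar>f z\<bar> powr p * snd z powr \<alpha>) \<partial>lborel)"
proof -
  define d where "d = real CARD('n) + 1"
  have DIM: "DIM((real ^ 'n) \<times> real) = CARD('n) + 1" by simp
  obtain \<kappa> c r where \<kappa>: "0 < \<kappa>" "\<kappa> \<le> 1" and \<Delta>: "\<And>j. \<Delta> j = cube (c j) (r j)"
    and \<eta>0: "\<And>j. 0 < snd (c j)" and r_ge: "\<And>j. \<kappa> * snd (c j) \<le> r j"
    and r_le: "\<And>j. r j \<le> snd (c j)" and bot: "\<And>j. \<kappa> * snd (c j) \<le> snd (c j) - r j"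
    by (fact whitney_cubes[OF W])
  obtain C0 where C0: "0 < C0" and sub_mean:
    "\<And>(f :: (real ^ 'n) \<times> real \<Rightarrow> real) S z R. harmonic_on f S \<Longrightarrow> open S \<Longrightarrow> 0 < R \<Longrightarrow>
      cball z R \<subseteq> S \<Longrightarrow> ennreal (\<bar>f z\<bar> powr p)
        \<le> ennreal (C0 / R ^ DIM((real ^ 'n) \<times> real)) * (\<integral>\<^sup>+w\<in>cball z R. ennreal (\<bar>f w\<bar> powr p) \<partial>lborel)"
    by (fact harmonic_powr_le_mean[OF p])
  note sub_mean = sub_mean[unfolded DIM]
  define \<eta> where "\<eta> j = snd (c j)" for j
  note \<eta>0 = \<eta>0[folded \<eta>_def] and r_ge = r_ge[folded \<eta>_def] and r_le = r_le[folded \<eta>_def]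
    and bot = bot[folded \<eta>_def]
  have r0: "0 < r j" for j using r_ge[of j] \<kappa> \<eta>0[of j] by (smt (verit) mult_pos_pos)
  define D where "D = norm (One :: (real ^ 'n) \<times> real)"
  have D: "D > 0" by (simp add: D_def)
  \<comment> \<open>A neighbourhood of the cube that contains all these balls: on the cube heights
    lie in [\<kappa> \<eta>, 2 \<eta>] and distances from the centre are at most D \<eta>, and the
    ball radius \<kappa> \<eta> / 2 <= \<eta> / 2 uses up the slack. Both height bounds serve the
    weight, as \<alpha> may have either sign.\<close>
  define N where "N j = {w. dist w (c j) \<le> \<eta> j * (D + 1) \<and> \<kappa> / 2 * \<eta> j \<le> snd w \<and> snd w \<le> 3 * \<eta> j}" for j
  define m where "m = min ((\<kappa> / 2) powr \<alpha>) (3 powr \<alpha>)"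
  have m: "m > 0" using \<kappa> by (simp add: m_def)
  have cl: "closed (N j)" for j
    unfolding N_def by (intro closed_Collect_conj closed_Collect_le continuous_intros)
  have [measurable]: "N j \<in> sets borel" for j using cl by (rule borel_closed)
  have NH: "N j \<subseteq> half_space" for j
    using \<kappa> \<eta>0[of j] by (auto simp: N_def mem_half_space) (smt (verit) mult_pos_pos)
  have \<Delta>_norm: "dist w (c j) \<le> \<eta> j * D" if "w \<in> \<Delta> j" for w j
  proof -
    have "dist w (c j) \<le> r j * D" using that cube_norm_le[of w "c j" "r j"] by (simp add: \<Delta> dist_norm D_def)
    also have "\<dots> \<le> \<eta> j * D" using r_le[of j] D by (intro mult_right_mono) auto
    finally show ?thesis .
  qed
  have ballN: "cball z (\<kappa> / 2 * \<eta> j) \<subseteq> N j" if z: "z \<in> \<Delta> j" for z j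
  proof
    fix w assume w: "w \<in> cball z (\<kappa> / 2 * \<eta> j)"
    have "\<kappa> / 2 * \<eta> j \<le> 1 * \<eta> j" using \<kappa> \<eta>0[of j] by (intro mult_right_mono) auto
    moreover have "\<bar>snd w - snd z\<bar> \<le> \<kappa> / 2 * \<eta> j"
      using w dist_snd_le[of z w] by (simp add: dist_real_def abs_minus_commute)
    moreover have "\<bar>snd z - \<eta> j\<bar> \<le> r j" using cube_snd[of z "c j" "r j"] z by (auto simp: \<Delta> \<eta>_def)
    moreover have "dist z w \<le> \<kappa> / 2 * \<eta> j" using w by simp
    ultimately have "\<kappa> / 2 * \<eta> j \<le> snd w" "snd w \<le> 3 * \<eta> j" "dist w z \<le> \<eta> j"
      using bot[of j] r_le[of j] unfolding dist_commute[of w z] by linarith+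
    then show "w \<in> N j"
      using \<Delta>_norm[OF z] dist_triangle[of w "c j" z] by (simp add: N_def distrib_left)
  qed
  \<comment> \<open>A point of height s in \<open>N j\<close> forces s / 3 <= \<eta>_j <= 2 s /
    \<kappa>: such cubes have half-side at least \<kappa> s / 3 and lie within M = (2 s / \<kappa>)
    (2 D + 1) of the point. In the quotient M / (\<kappa> s / 3) the height cancels.\<close>
  define N0 where "N0 = (6 * (2 * D + 1) / \<kappa>\<^sup>2) ^ (CARD('n) + 1)"
  have overlap: "(\<Sum>j. indicator (N j) w :: ennreal) \<le> ennreal N0" for w
  proof (rule suminf_le_const)
    fix n
    define F where "F = {j. j < n \<and> w \<in> N j}"
    have "(\<Sum>j<n. indicator (N j) w :: ennreal) = (\<Sum>j\<in>F. 1)"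
      by (rule sum.mono_neutral_cong_right) (auto simp: F_def)
    also have "\<dots> = ennreal (card F)" by (simp add: ennreal_of_nat_eq_real_of_nat)
    also have "\<dots> \<le> ennreal N0"
    proof (rule ennreal_leI, cases "F = {}")
      case False
      define s where "s = snd w"
      obtain j where "w \<in> N j" using False by (auto simp: F_def)
      then have "w \<in> half_space" using NH by blast
      then have s: "s > 0" by (simp add: s_def mem_half_space)
      define M where "M = 2 * s / \<kappa> * (2 * D + 1)"
      have "card F \<le> (M / (\<kappa> * s / 3)) ^ DIM((real ^ 'n) \<times> real)"
      proof (rule card_disjoint_cubes_le[of _ _ _ r c w])
        show "finite F" by (simp add: F_def)
        show "0 < \<kappa> * s / 3" "0 \<le> M" using \<kappa> s D by (auto simp: M_def)
        show "\<kappa> * s / 3 \<le> r j" if "j \<in> F" for j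
        proof -
          have "\<kappa> * s \<le> \<kappa> * (3 * \<eta> j)" using that \<kappa> by (intro mult_left_mono) (auto simp: F_def N_def s_def)
          then show ?thesis using r_ge[of j] by linarith
        qed
        show "cube (c j) (r j) \<subseteq> cube w M" if j: "j \<in> F" for j
        proof
          fix z assume "z \<in> cube (c j) (r j)"
          then have "dist z (c j) \<le> \<eta> j * D" using \<Delta>_norm \<Delta> by simp
          then have "dist w z \<le> \<eta> j * (2 * D + 1)"
            using j dist_triangle[of w z "c j"] dist_commute[of z "c j"]
            by (auto simp: F_def N_def algebra_simps)
          also have "\<dots> \<le> 2 * s / \<kappa> * (2 * D + 1)"
            using j D \<kappa> by (intro mult_right_mono) (auto simp: F_def N_def s_def field_simps)
          finally show "z \<in> cube w M"
            using cball_subset_cube[of w M] by (auto simp: M_def)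
        qed
        show "interior (cube (c i) (r i)) \<inter> interior (cube (c j) (r j)) = {}" if "i \<noteq> j" for i j
          using W that unfolding \<Delta>[symmetric] whitney_decomposition_def by blast
      qed
      also have "M / (\<kappa> * s / 3) = 6 * (2 * D + 1) / \<kappa>\<^sup>2"
        using s \<kappa> by (simp add: M_def field_simps power2_eq_square)
      finally show "real (card F) \<le> N0" by (simp add: N0_def)
    qed (use D \<kappa> in \<open>auto simp: N0_def\<close>)
    finally show "(\<Sum>j<n. indicator (N j) w :: ennreal) \<le> ennreal N0" .
  qed auto
  define C1 where "C1 = C0 * (2 / \<kappa>) ^ (CARD('n) + 1) / m * (K * 2 powr (d + \<alpha>))"
  have C1: "C1 > 0" using C0 \<kappa> m K by (auto simp: C1_def)
  have N0: "N0 > 0" using D \<kappa> by (auto simp: N0_def intro!: divide_pos_pos mult_pos_pos)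
  show thesis
  proof (rule that[of "C1 * N0"])
    show "0 < C1 * N0" using C1 N0 by simp
    fix f :: "(real ^ 'n) \<times> real \<Rightarrow> real"
    assume harm: "harmonic_on f half_space"
    have cont: "continuous_on half_space f" by (rule harmonic_on_continuous[OF harm open_half_space])
    have contp: "continuous_on half_space (\<lambda>z. \<bar>f z\<bar> powr p)"
      using cont p by (rule continuous_on_abs_powr)
    define g where "g z = ennreal (\<bar>f z\<bar> powr p * snd z powr \<alpha>) * indicator half_space z" for z
    have g[measurable]: "g \<in> borel_measurable borel"
    proof -
      have "continuous_on half_space (\<lambda>z. \<bar>f z\<bar> powr p * snd z powr \<alpha>)"
        by (intro continuous_intros contp) (auto simp: mem_half_space)
      from borel_measurable_continuous_on_indicator[OF borel_open[OF open_half_space] this]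
      have "(\<lambda>z. ennreal (indicator half_space z *\<^sub>R (\<bar>f z\<bar> powr p * snd z powr \<alpha>))) \<in> borel_measurable borel"
        by (intro measurable_compose[OF _ measurable_ennreal]) auto
      moreover have "(\<lambda>z. ennreal (indicator half_space z *\<^sub>R (\<bar>f z\<bar> powr p * snd z powr \<alpha>))) = g"
        by (auto simp: g_def indicator_def)
      ultimately show ?thesis by (simp only:)
    qed
    have \<Delta>_sets: "\<Delta> j \<in> sets \<mu>" for j
      using W by (auto simp: sets_half_space_restrict[OF \<mu>] whitney_decomposition_def \<Delta> cube_def)
    have fp: "(\<lambda>z. ennreal (\<bar>f z\<bar> powr p)) \<in> borel_measurable \<mu>"
      using borel_measurable_half_space_restrict[OF \<mu> contp] by measurable
    have cube_le: "(\<integral>\<^sup>+z\<in>\<Delta> j. ennreal (\<bar>f z\<bar> powr p) \<partial>\<mu>) \<le> ennreal C1 * (\<integral>\<^sup>+z. g z * indicator (N j) z \<partial>lborel)" for j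
    proof -
      define J where "J = (\<integral>\<^sup>+z. g z * indicator (N j) z \<partial>lborel)"
      define R where "R = \<kappa> / 2 * \<eta> j"
      have R: "R > 0" using \<kappa> \<eta>0[of j] by (simp add: R_def)
      \<comment> \<open>The first factor comes from the sub-mean value inequality at radius
        \<open>R\<close>, the second from inserting the weight.\<close>
      define A where "A = C0 / R ^ (CARD('n) + 1) * (1 / (m * \<eta> j powr \<alpha>))"
      have sup: "ennreal (\<bar>f z\<bar> powr p) \<le> ennreal A * J" if z: "z \<in> \<Delta> j" for z
      proof -
        have "ennreal (\<bar>f z\<bar> powr p) \<le> ennreal (C0 / R ^ (CARD('n) + 1)) * (\<integral>\<^sup>+w\<in>cball z R. ennreal (\<bar>f w\<bar> powr p) \<partial>lborel)"
          using ballN[OF z] NH[of j] R by (intro sub_mean[OF harm open_half_space]) (auto simp: R_def)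
        also have "(\<integral>\<^sup>+w\<in>cball z R. ennreal (\<bar>f w\<bar> powr p) \<partial>lborel)
          \<le> (\<integral>\<^sup>+w. ennreal (1 / (m * \<eta> j powr \<alpha>)) * (g w * indicator (N j) w) \<partial>lborel)"
        proof (rule nn_integral_mono)
          fix w
          show "ennreal (\<bar>f w\<bar> powr p) * indicator (cball z R) w
            \<le> ennreal (1 / (m * \<eta> j powr \<alpha>)) * (g w * indicator (N j) w)"
          proof (cases "w \<in> cball z R")
            case True
            then have w: "w \<in> N j" using ballN[OF z] by (auto simp: R_def)
            then have wH: "w \<in> half_space" using NH by auto
            have "m * \<eta> j powr \<alpha> \<le> snd w powr \<alpha>"
              unfolding m_def using w \<kappa> \<eta>0[of j] by (intro powr_ge_min_of_ratio) (auto simp: N_def)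
            then have "\<bar>f w\<bar> powr p * (m * \<eta> j powr \<alpha>) \<le> \<bar>f w\<bar> powr p * snd w powr \<alpha>"
              by (intro mult_left_mono) auto
            then have "\<bar>f w\<bar> powr p \<le> 1 / (m * \<eta> j powr \<alpha>) * (\<bar>f w\<bar> powr p * snd w powr \<alpha>)"
              using m \<eta>0[of j] by (simp add: field_simps)
            then have "ennreal (\<bar>f w\<bar> powr p) \<le> ennreal (1 / (m * \<eta> j powr \<alpha>) * (\<bar>f w\<bar> powr p * snd w powr \<alpha>))"
              by (rule ennreal_leI)
            also have "\<dots> = ennreal (1 / (m * \<eta> j powr \<alpha>)) * ennreal (\<bar>f w\<bar> powr p * snd w powr \<alpha>)"
              using m by (intro ennreal_mult') auto
            finally show ?thesis using True w wH by (simp add: g_def)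
          qed auto
        qed
        also have "\<dots> = ennreal (1 / (m * \<eta> j powr \<alpha>)) * J"
          unfolding J_def by (rule nn_integral_cmult) measurable
        finally have "ennreal (\<bar>f z\<bar> powr p) \<le> ennreal (C0 / R ^ (CARD('n) + 1)) * (ennreal (1 / (m * \<eta> j powr \<alpha>)) * J)"
          by (simp add: mult_left_mono)
        also have "\<dots> = ennreal A * J"
          unfolding A_def using C0 R by (subst ennreal_mult') (auto simp: mult.assoc)
        finally show ?thesis .
      qed
      have "(\<integral>\<^sup>+z\<in>\<Delta> j. ennreal (\<bar>f z\<bar> powr p) \<partial>\<mu>) \<le> (\<integral>\<^sup>+z. (ennreal A * J) * indicator (\<Delta> j) z \<partial>\<mu>)"
        using sup by (intro nn_integral_mono) (auto simp: indicator_def)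
      also have "\<dots> = ennreal A * J * emeasure \<mu> (\<Delta> j)"
        using \<Delta>_sets by (rule nn_integral_cmult_indicator)
      also have "\<dots> \<le> ennreal A * J * ennreal (K * 2 powr (d + \<alpha>) * \<eta> j powr (d + \<alpha>))"
      proof (intro mult_left_mono order_trans[OF le] ennreal_leI)
        have "measure lborel (\<Delta> j) = (2 * r j) ^ (CARD('n) + 1)"
          using r0[of j] by (simp add: \<Delta> measure_cube)
        also have "\<dots> = (2 * r j) powr real (CARD('n) + 1)"
          by (rule powr_realpow[symmetric]) (use r0 in simp)
        also have "real (CARD('n) + 1) = d" by (simp add: d_def)
        finally have m\<Delta>: "measure lborel (\<Delta> j) = (2 * r j) powr d" .
        have "measure lborel (\<Delta> j) powr (1 + \<alpha> / (real CARD('n) + 1)) = (2 * r j) powr (d + \<alpha>)"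
        proof -
          have "d > 0" by (auto simp: d_def intro: add_nonneg_pos)
          then have "d * (1 + \<alpha> / d) = d + \<alpha>" by (simp add: field_simps)
          then show ?thesis using m\<Delta> by (simp add: powr_powr flip: d_def)
        qed
        also have "\<dots> \<le> (2 * \<eta> j) powr (d + \<alpha>)"
          using r_le[of j] r0[of j] \<alpha> by (intro powr_mono2) (auto simp: d_def)
        finally have "measure lborel (\<Delta> j) powr (1 + \<alpha> / (real CARD('n) + 1)) \<le> 2 powr (d + \<alpha>) * \<eta> j powr (d + \<alpha>)"
          by (simp add: powr_mult)
        then show "K * measure lborel (\<Delta> j) powr (1 + \<alpha> / (real CARD('n) + 1)) \<le> K * 2 powr (d + \<alpha>) * \<eta> j powr (d + \<alpha>)"
          using K by simp
      qed auto
      also have "\<dots> = ennreal (A * (K * 2 powr (d + \<alpha>) * \<eta> j powr (d + \<alpha>))) * J"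
        using C0 R m K by (subst ennreal_mult') (auto simp: A_def mult_ac)
      \<comment> \<open>The powers \<eta>^(-(n+1)), \<eta>^(-\<alpha>) and \<eta>^(n+1+\<alpha>)
        cancel, so the constant does not depend on the cube.\<close>
      also have "A * (K * 2 powr (d + \<alpha>) * \<eta> j powr (d + \<alpha>)) = C1"
      proof -
        have "\<eta> j powr d = \<eta> j powr real (CARD('n) + 1)" by (simp add: d_def add.commute)
        also have "\<dots> = \<eta> j ^ (CARD('n) + 1)" by (rule powr_realpow[OF \<eta>0])
        finally have Rp: "R ^ (CARD('n) + 1) = (\<kappa> / 2) ^ (CARD('n) + 1) * \<eta> j powr d"
          by (simp only: R_def power_mult_distrib)
        have \<kappa>p: "(2 / \<kappa>) ^ (CARD('n) + 1) = 1 / (\<kappa> / 2) ^ (CARD('n) + 1)"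
          by (simp add: power_divide)
        have "C0 / (k * y) * (1 / (m * v)) * (K * P * (y * v)) = C0 * (1 / k) / m * (K * P)"
          if "k \<noteq> 0" "y \<noteq> 0" "v \<noteq> 0" for k y v P :: real
          using that m by (simp add: field_simps)
        then show ?thesis
          unfolding A_def C1_def Rp \<kappa>p powr_add[of "\<eta> j"]
          using \<eta>0[of j] \<kappa> by (metis less_irrefl powr_eq_0_iff power_not_zero half_gt_zero)
      qed
      finally show ?thesis by (simp add: J_def)
    qed
    have "(\<integral>\<^sup>+z\<in>half_space. ennreal (\<bar>f z\<bar> powr p) \<partial>\<mu>)
        \<le> (\<integral>\<^sup>+z. (\<Sum>j. ennreal (\<bar>f z\<bar> powr p) * indicator (\<Delta> j) z) \<partial>\<mu>)"
    \<comment> \<open>Neighbouring cubes share faces, which \<mu> may charge, so the covering gives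
      an inequality.\<close>
    proof (rule nn_integral_mono)
      fix z
      show "ennreal (\<bar>f z\<bar> powr p) * indicator half_space z \<le> (\<Sum>j. ennreal (\<bar>f z\<bar> powr p) * indicator (\<Delta> j) z)"
      proof (cases "z \<in> half_space")
        case True
        then obtain j where j: "z \<in> \<Delta> j" using W unfolding whitney_decomposition_def by blast
        have "(\<Sum>i\<in>{j}. ennreal (\<bar>f z\<bar> powr p) * indicator (\<Delta> i) z) \<le> (\<Sum>j. ennreal (\<bar>f z\<bar> powr p) * indicator (\<Delta> j) z)"
          by (rule sum_le_suminf) auto
        then show ?thesis using j True by simp
      qed auto
    qed
    also have "\<dots> = (\<Sum>j. \<integral>\<^sup>+z\<in>\<Delta> j. ennreal (\<bar>f z\<bar> powr p) \<partial>\<mu>)"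
      by (intro nn_integral_suminf borel_measurable_times_ennreal fp borel_measurable_indicator \<Delta>_sets)
    also have "\<dots> \<le> (\<Sum>j. ennreal C1 * (\<integral>\<^sup>+z. g z * indicator (N j) z \<partial>lborel))"
      by (intro suminf_le cube_le) auto
    also have "\<dots> = ennreal C1 * (\<Sum>j. \<integral>\<^sup>+z. g z * indicator (N j) z \<partial>lborel)"
      by (rule ennreal_suminf_cmult)
    also have "(\<Sum>j. \<integral>\<^sup>+z. g z * indicator (N j) z \<partial>lborel) = (\<integral>\<^sup>+z. (\<Sum>j. g z * indicator (N j) z) \<partial>lborel)"
      by (intro nn_integral_suminf[symmetric]) measurable
    also have "\<dots> = (\<integral>\<^sup>+z. g z * (\<Sum>j. indicator (N j) z) \<partial>lborel)"
      by (simp add: ennreal_suminf_cmult)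
    also have "\<dots> \<le> (\<integral>\<^sup>+z. g z * ennreal N0 \<partial>lborel)"
      by (intro nn_integral_mono mult_left_mono overlap) auto
    also have "\<dots> = ennreal N0 * (\<integral>\<^sup>+z. g z \<partial>lborel)"
      by (subst nn_integral_multc) (auto simp: mult.commute)
    finally have "(\<integral>\<^sup>+z\<in>half_space. ennreal (\<bar>f z\<bar> powr p) \<partial>\<mu>) \<le> ennreal C1 * (ennreal N0 * (\<integral>\<^sup>+z. g z \<partial>lborel))"
      by (simp add: mult_left_mono)
    then show "(\<integral>\<^sup>+z\<in>half_space. ennreal (\<bar>f z\<bar> powr p) \<partial>\<mu>)
      \<le> ennreal (C1 * N0) * (\<integral>\<^sup>+z\<in>half_space. ennreal (\<bar>f z\<bar> powr p * snd z powr \<alpha>) \<partial>lborel)"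
      using C1 N0 by (simp add: g_def ennreal_mult mult.assoc)
  qed
qed

section \<open>Kelvin transforms of harmonic polynomials\<close>

text \<open>\<open>partial_deriv\<close> is a total function, so formulas for derivatives are known
  for it on \<open>S\<close> only; openness of \<open>S\<close> lets them be differentiated once
  more.\<close>

lemma harmonic_onI:
  fixes f :: "'a::euclidean_space \<Rightarrow> real"
  assumes S: "open S"
    and f': "\<And>x. x \<in> S \<Longrightarrow> (f has_derivative f' x) (at x)"
    and f'': "\<And>x b. x \<in> S \<Longrightarrow> b \<in> Basis \<Longrightarrow> ((\<lambda>x. f' x b) has_derivative f'' b x) (at x)"
    and cont: "\<And>b c. b \<in> Basis \<Longrightarrow> c \<in> Basis \<Longrightarrow> continuous_on S (\<lambda>x. f'' b x c)"
    and lap: "\<And>x. x \<in> S \<Longrightarrow> (\<Sum>b\<in>Basis. f'' b x b) = 0"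
  shows "harmonic_on f S"
proof -
  have p1: "partial_deriv b f x = f' x b" if "x \<in> S" for b x
    using frechet_derivative_at[OF f'[OF that]] by (simp add: partial_deriv_def)
  have d1: "(partial_deriv b f has_derivative f'' b x) (at x)" if "x \<in> S" "b \<in> Basis" for b x
    by (rule has_derivative_transform_within_open[OF f''[OF that] S that(1)]) (simp add: p1)
  have p2: "partial_deriv c (partial_deriv b f) x = f'' b x c" if "x \<in> S" "b \<in> Basis" for b c x
    using frechet_derivative_at[OF d1[OF that]] by (simp add: partial_deriv_def[of c])
  have "continuous_on S (partial_deriv c (partial_deriv b f))" if "b \<in> Basis" "c \<in> Basis" for b c
    by (rule continuous_on_eq[OF cont[OF that]]) (simp add: p2 that)
  moreover have "f differentiable_on S" "\<And>b. b \<in> Basis \<Longrightarrow> partial_deriv b f differentiable_on S"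
    using differentiableI[OF f'] differentiableI[OF d1]
    by (auto simp: differentiable_on_eq_differentiable_at[OF S])
  ultimately show ?thesis
    unfolding harmonic_on_def C2_on_def laplacian_def using lap by (simp add: p2)
qed

definition planar :: "'a::euclidean_space \<Rightarrow> 'a \<Rightarrow> 'a \<Rightarrow> complex" where
  "planar e0 e1 w = of_real (w \<bullet> e0) + \<i> * of_real (w \<bullet> e1)"

text \<open>Kelvin transform of the harmonic polynomial \<open>Re (w\<^sub>0 + i w\<^sub>1)\<^sup>m\<close>.\<close>

definition kelvin :: "'a::euclidean_space \<Rightarrow> 'a \<Rightarrow> nat \<Rightarrow> 'a \<Rightarrow> real" where
  "kelvin e0 e1 m w = Re (planar e0 e1 w ^ m) * (w \<bullet> w) powr (- (m + DIM('a) / 2 - 1))"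

text \<open>The constant factor \<open>c\<close> makes the rule reusable for second derivatives,
  where \<open>c\<close> is the planar image of a basis vector.\<close>

lemma has_derivative_planar_power:
  "((\<lambda>w. Re (planar e0 e1 w ^ m * c)) has_derivative
    (\<lambda>v. m * Re (planar e0 e1 w ^ (m - 1) * planar e0 e1 v * c))) (at w)"
proof -
  have "((\<lambda>w. Re (planar e0 e1 w ^ m * c)) has_derivative
      (\<lambda>v. Re (of_nat m * planar e0 e1 v * planar e0 e1 w ^ (m - 1) * c))) (at w)"
    unfolding planar_def by (intro derivative_eq_intros refl) (auto simp: algebra_simps)
  moreover have "Re (of_nat m * planar e0 e1 v * planar e0 e1 w ^ (m - 1) * c)
      = m * Re (planar e0 e1 w ^ (m - 1) * planar e0 e1 v * c)" for v
  proof -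
    have "of_nat m * planar e0 e1 v * planar e0 e1 w ^ (m - 1) * c
        = real m *\<^sub>R (planar e0 e1 w ^ (m - 1) * planar e0 e1 v * c)"
      by (simp add: scaleR_conv_of_real)
    then show ?thesis by (simp only: scaleR_complex.simps)
  qed
  ultimately show ?thesis by simp
qed

lemma has_derivative_inner_self_powr:
  fixes w :: "'a::euclidean_space"
  assumes "w \<noteq> 0"
  shows "((\<lambda>w. (w \<bullet> w) powr a) has_derivative (\<lambda>v. 2 * a * (w \<bullet> w) powr (a - 1) * (w \<bullet> v))) (at w)"
proof -
  have "((\<lambda>x. x powr a) has_real_derivative a * (w \<bullet> w) powr (a - 1)) (at (w \<bullet> w))"
    using assms by (intro has_real_derivative_powr) simp
  then have "((\<lambda>x. x powr a) has_derivative (*) (a * (w \<bullet> w) powr (a - 1))) (at (w \<bullet> w))"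
    by (simp add: has_field_derivative_def)
  moreover have "((\<lambda>w. w \<bullet> w) has_derivative (\<lambda>v. w \<bullet> v + v \<bullet> w)) (at w)"
    by (auto intro!: derivative_eq_intros)
  ultimately have "((\<lambda>w. (w \<bullet> w) powr a) has_derivative
      (\<lambda>v. a * (w \<bullet> w) powr (a - 1) * (w \<bullet> v + v \<bullet> w))) (at w)"
    by (rule has_derivative_compose[rotated])
  then show ?thesis
    by (rule has_derivative_eq_rhs) (auto simp: fun_eq_iff inner_commute algebra_simps)
qed

text \<open>Expansion of a linear functional in the basis; for \<open>z\<close> the power m - 1 of
  \<open>planar e0 e1 w\<close> it is, up to the factor m, Euler's identity for a homogeneous
  polynomial.\<close>

lemma sum_planar_mult_inner:
  "(\<Sum>b\<in>Basis. Re (z * planar e0 e1 b) * (w \<bullet> b)) = Re (z * planar e0 e1 w)"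
proof -
  have lin: "linear (\<lambda>v. Re (z * planar e0 e1 v))"
    by (rule linearI) (auto simp: planar_def inner_simps algebra_simps)
  have "Re (z * planar e0 e1 w) = Re (z * planar e0 e1 (\<Sum>b\<in>Basis. (w \<bullet> b) *\<^sub>R b))"
    by (simp add: euclidean_representation)
  also have "\<dots> = (\<Sum>b\<in>Basis. Re (z * planar e0 e1 b) * (w \<bullet> b))"
    using linear_sum[OF lin, of "\<lambda>b. (w \<bullet> b) *\<^sub>R b" Basis] linear_cmul[OF lin]
    by (simp add: mult.commute)
  finally show ?thesis by simp
qed

text \<open>1 + i^2 = 0: the isotropy that makes real parts of powers of
  \<open>planar e0 e1 w\<close> harmonic.\<close>

lemma sum_planar_square:
  assumes e: "e0 \<in> Basis" "e1 \<in> Basis" "e0 \<noteq> e1"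
  shows "(\<Sum>b\<in>Basis. planar e0 e1 b * planar e0 e1 b) = 0"
proof -
  have "(\<Sum>b\<in>Basis. planar e0 e1 b * planar e0 e1 b) = (\<Sum>b\<in>{e0, e1}. planar e0 e1 b * planar e0 e1 b)"
    using e by (intro sum.mono_neutral_right) (auto simp: planar_def inner_Basis)
  also have "\<dots> = 0" using e by (simp add: planar_def inner_Basis)
  finally show ?thesis .
qed

text \<open>Let Q be the real part of the m-th power of \<open>planar e0 e1 w\<close>. As Q is
  harmonic and homogeneous of degree m, the Laplacian of Q |w|^(-2a) is 2 a Q |w|^(-2a-2) (2 (a + 1)
  - 2 m - d), and a = m + d/2 - 1 makes the last factor vanish.\<close>

lemma harmonic_on_kelvin:
  fixes e0 e1 w0 :: "'a::euclidean_space"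
  assumes e: "e0 \<in> Basis" "e1 \<in> Basis" "e0 \<noteq> e1" and m: "1 \<le> m"
    and S: "open S" and w0: "w0 \<notin> S"
  shows "harmonic_on (\<lambda>w. kelvin e0 e1 m (w - w0)) S"
proof -
  define a where "a = m + DIM('a) / 2 - 1"
  define P where "P = planar e0 e1"
  define N where "N w = w \<bullet> w" for w :: 'a
  \<comment> \<open>Closed forms of the derivative of the kernel in direction \<open>v\<close>, and
    of the derivative of \<open>K1 w b\<close> in direction \<open>v\<close>. The truncated exponent
    m - 2 does no harm at m = 1, where its term carries the factor m - 1 = 0.\<close>
  define K1 where "K1 w v = (m * Re (P w ^ (m - 1) * P v)) * N w powr (- a)
      - 2 * a * (Re (P w ^ m) * N w powr (- a - 1) * (w \<bullet> v))" for w v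
  define K2 where "K2 b w v = m * ((m - 1) * Re (P w ^ (m - 2) * P v * P b) * N w powr (- a)
      - 2 * a * Re (P w ^ (m - 1) * P b) * N w powr (- a - 1) * (w \<bullet> v))
      - 2 * a * (m * Re (P w ^ (m - 1) * P v) * N w powr (- a - 1) * (w \<bullet> b)
        - 2 * (a + 1) * Re (P w ^ m) * N w powr (- a - 2) * (w \<bullet> v) * (w \<bullet> b)
        + Re (P w ^ m) * N w powr (- a - 1) * (v \<bullet> b))" for b w v
  have Dpow: "((\<lambda>w. Re (P w ^ k * c)) has_derivative (\<lambda>v. k * Re (P w ^ (k - 1) * P v * c))) (at w)" for k c w
    unfolding P_def by (rule has_derivative_planar_power)
  have DN: "((\<lambda>w. N w powr s) has_derivative (\<lambda>v. 2 * s * N w powr (s - 1) * (w \<bullet> v))) (at w)"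
    if "w \<noteq> 0" for w s
    unfolding N_def using that by (rule has_derivative_inner_self_powr)
  have kel: "kelvin e0 e1 m = (\<lambda>w. Re (P w ^ m * 1) * N w powr (- a))"
    by (simp add: fun_eq_iff kelvin_def P_def N_def a_def)
  have D1: "(kelvin e0 e1 m has_derivative K1 w) (at w)" if "w \<noteq> 0" for w
    unfolding kel
    by (rule has_derivative_eq_rhs[OF has_derivative_mult[OF Dpow DN[OF that]]])
       (auto simp: K1_def fun_eq_iff algebra_simps)
  have D2: "((\<lambda>w. K1 w b) has_derivative K2 b w) (at w)" if "w \<noteq> 0" for w b
  proof -
    have 1: "((\<lambda>w. m * (Re (P w ^ (m - 1) * P b) * N w powr (- a))) has_derivative
      (\<lambda>v. m * (Re (P w ^ (m - 1) * P b) * (2 * (- a) * N w powr (- a - 1) * (w \<bullet> v))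
        + (real (m - 1) * Re (P w ^ (m - 1 - 1) * P v * P b)) * N w powr (- a)))) (at w)"
      by (intro has_derivative_mult_right has_derivative_mult Dpow DN that)
    have 2: "((\<lambda>w. 2 * a * ((Re (P w ^ m * 1) * N w powr (- a - 1)) * (w \<bullet> b))) has_derivative
      (\<lambda>v. 2 * a * ((Re (P w ^ m * 1) * N w powr (- a - 1)) * (v \<bullet> b)
        + (Re (P w ^ m * 1) * (2 * (- a - 1) * N w powr (- a - 1 - 1) * (w \<bullet> v))
        + m * Re (P w ^ (m - 1) * P v * 1) * N w powr (- a - 1)) * (w \<bullet> b)))) (at w)"
      by (intro has_derivative_mult_right has_derivative_mult Dpow DN that has_derivative_inner_left has_derivative_ident)
    have "- a - 1 - 1 = - a - 2" "m - 1 - 1 = m - 2" "real (m - 1) = real m - 1" using m by auto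
    with has_derivative_diff[OF 1 2] show ?thesis
      by (simp add: K1_def[abs_def] K2_def[abs_def] algebra_simps)
  qed
  have lap: "(\<Sum>b\<in>Basis. K2 b w b) = 0" if w: "w \<noteq> 0" for w
  proof -
    have s1: "(\<Sum>b\<in>Basis. Re (P w ^ (m - 2) * P b * P b)) = 0"
    proof -
      have "(\<Sum>b\<in>Basis. Re (P w ^ (m - 2) * P b * P b)) = Re (P w ^ (m - 2) * (\<Sum>b\<in>Basis. P b * P b))"
        by (simp only: Re_sum[symmetric] sum_distrib_left mult.assoc)
      then show ?thesis unfolding P_def sum_planar_square[OF e] by simp
    qed
    have s2: "(\<Sum>b\<in>Basis. Re (P w ^ (m - 1) * P b) * (w \<bullet> b)) = Re (P w ^ m)"
      unfolding P_def sum_planar_mult_inner using m by (simp flip: power_Suc2)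
    have s3: "(\<Sum>b\<in>Basis. (w \<bullet> b) * (w \<bullet> b)) = N w" unfolding N_def by (rule euclidean_inner[symmetric])
    have s4: "(\<Sum>b\<in>(Basis :: 'a set). b \<bullet> b) = real (DIM('a))" by simp
    have "(\<Sum>b\<in>Basis. K2 b w b)
      = real m * real (m - 1) * N w powr (- a) * (\<Sum>b\<in>Basis. Re (P w ^ (m - 2) * P b * P b))
        - 4 * a * m * N w powr (- a - 1) * (\<Sum>b\<in>Basis. Re (P w ^ (m - 1) * P b) * (w \<bullet> b))
        + 4 * a * (a + 1) * Re (P w ^ m) * N w powr (- a - 2) * (\<Sum>b\<in>Basis. (w \<bullet> b) * (w \<bullet> b))
        - 2 * a * Re (P w ^ m) * N w powr (- a - 1) * (\<Sum>b\<in>(Basis :: 'a set). b \<bullet> b)"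
    proof -
      have "K2 b w b = real m * real (m - 1) * N w powr (- a) * Re (P w ^ (m - 2) * P b * P b)
        - 4 * a * m * N w powr (- a - 1) * (Re (P w ^ (m - 1) * P b) * (w \<bullet> b))
        + 4 * a * (a + 1) * Re (P w ^ m) * N w powr (- a - 2) * ((w \<bullet> b) * (w \<bullet> b))
        - 2 * a * Re (P w ^ m) * N w powr (- a - 1) * (b \<bullet> b)" for b
        unfolding K2_def by (simp add: algebra_simps)
      then show ?thesis by (simp only: sum.distrib sum_subtractf sum_distrib_left[symmetric])
    qed
    also have "\<dots> = 2 * a * Re (P w ^ m) * (N w powr (- a - 1) * (- 2 * m - DIM('a))
        + 2 * (a + 1) * (N w powr (- a - 2) * N w))"
      unfolding s1 s2 s3 s4 by (simp add: algebra_simps)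
    also have "N w powr (- a - 2) * N w = N w powr (- a - 1)"
    proof -
      have "N w powr (- a - 2) * N w powr 1 = N w powr (- a - 2 + 1)" by (rule powr_add[symmetric])
      moreover have "- a - 2 + 1 = - a - 1" by simp
      ultimately show ?thesis by (simp only: powr_one inner_ge_zero N_def)
    qed
    also have "N w powr (- a - 1) * (- 2 * m - DIM('a)) + 2 * (a + 1) * N w powr (- a - 1) = 0"
      by (simp add: a_def algebra_simps)
    finally show ?thesis by simp
  qed
  have contK2: "continuous_on (- {0}) (\<lambda>w. K2 b w v)" for b v
    unfolding K2_def P_def N_def planar_def by (intro continuous_intros) auto
  have nz: "x - w0 \<noteq> 0" if "x \<in> S" for x using that w0 by auto
  have shift: "((\<lambda>x. g (x - w0)) has_derivative g') (at x)" if "(g has_derivative g') (at (x - w0))" for g g' x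
  proof -
    have "((\<lambda>x. x - w0) has_derivative (\<lambda>v. v)) (at x)" by (auto intro!: derivative_eq_intros)
    from has_derivative_compose[OF this that] show ?thesis .
  qed
  show ?thesis
  proof (rule harmonic_onI[OF S, of _ "\<lambda>x. K1 (x - w0)" "\<lambda>b x. K2 b (x - w0)"])
    fix x assume "x \<in> S"
    then show "((\<lambda>w. kelvin e0 e1 m (w - w0)) has_derivative K1 (x - w0)) (at x)"
      by (intro shift D1 nz)
  next
    fix x b assume "x \<in> S"
    then show "((\<lambda>x. K1 (x - w0) b) has_derivative K2 b (x - w0)) (at x)"
      by (intro shift[of "\<lambda>x. K1 x b"] D2 nz)
  next
    fix b c
    show "continuous_on S (\<lambda>x. K2 b (x - w0) c)"
      by (rule continuous_on_compose2[OF contK2]) (use nz in \<open>auto intro!: continuous_intros\<close>)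
  next
    fix x assume "x \<in> S"
    then show "(\<Sum>b\<in>Basis. K2 b (x - w0) b) = 0" by (intro lap nz)
  qed
qed

section \<open>Size, homogeneity and sign of the kernel\<close>

text \<open>The modulus of \<open>planar e0 e1 w\<close> is at most |w| because e0 and e1 are
  orthonormal, and the degrees add up to m - 2 (m + d/2 - 1) = -(m + d - 2). At the origin both
  sides are 0, by the convention for \<open>0 powr x\<close>.\<close>

lemma abs_kelvin_le:
  fixes w :: "'a::euclidean_space"
  assumes e: "e0 \<in> Basis" "e1 \<in> Basis" "e0 \<noteq> e1"
  shows "\<bar>kelvin e0 e1 m w\<bar> \<le> norm w powr (- (real m + real DIM('a) - 2))"
proof (cases "w = 0")
  case False
  have "cmod (planar e0 e1 w) ^ 2 = (\<Sum>b\<in>{e0, e1}. (w \<bullet> b)\<^sup>2)"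
    using e unfolding cmod_power2 by (simp add: planar_def)
  also have "\<dots> \<le> (\<Sum>b\<in>Basis. (w \<bullet> b)\<^sup>2)" using e by (intro sum_mono2) auto
  also have "\<dots> = norm w ^ 2"
    by (subst power2_norm_eq_inner, subst euclidean_inner) (simp add: power2_eq_square)
  finally have "cmod (planar e0 e1 w) \<le> norm w" by (rule power2_le_imp_le) simp
  then have "\<bar>Re (planar e0 e1 w ^ m)\<bar> \<le> norm w ^ m"
    using abs_Re_le_cmod[of "planar e0 e1 w ^ m"] power_mono[of "cmod (planar e0 e1 w)" "norm w" m]
    by (simp add: norm_power)
  then have "\<bar>kelvin e0 e1 m w\<bar> \<le> norm w ^ m * (w \<bullet> w) powr (- (m + DIM('a) / 2 - 1))"
    unfolding kelvin_def abs_mult by (auto intro!: mult_right_mono)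
  also have "\<dots> = norm w powr (m + 2 * (- (m + DIM('a) / 2 - 1)))"
  proof -
    have "w \<bullet> w = norm w powr 2" using False by (simp add: power2_norm_eq_inner[symmetric])
    moreover have "norm w ^ m = norm w powr m" using False by (simp add: powr_realpow)
    ultimately show ?thesis by (simp only: powr_powr powr_add)
  qed
  also have "m + 2 * (- (m + DIM('a) / 2 - 1)) = - (real m + real DIM('a) - 2)"
    by (simp add: algebra_simps)
  finally show ?thesis .
qed (simp add: kelvin_def)

lemma kelvin_scale:
  fixes w :: "'a::euclidean_space"
  assumes s: "0 < s"
  shows "kelvin e0 e1 m (s *\<^sub>R w) = s powr (- (real m + real DIM('a) - 2)) * kelvin e0 e1 m w"
proof -
  have P: "planar e0 e1 (s *\<^sub>R w) = s *\<^sub>R planar e0 e1 w"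
    by (simp add: planar_def scaleR_conv_of_real algebra_simps)
  have "s *\<^sub>R w \<bullet> s *\<^sub>R w = s powr 2 * (w \<bullet> w)" using s by (simp add: power2_eq_square)
  then have "(s *\<^sub>R w \<bullet> s *\<^sub>R w) powr c = s powr (2 * c) * (w \<bullet> w) powr c" for c
    by (simp only: powr_mult powr_powr)
  then have "kelvin e0 e1 m (s *\<^sub>R w) = (s powr m * s powr (2 * (- (m + DIM('a) / 2 - 1)))) * kelvin e0 e1 m w"
    using s by (simp only: kelvin_def P scaleR_power scaleR_complex.simps powr_realpow) simp
  also have "s powr m * s powr (2 * (- (m + DIM('a) / 2 - 1))) = s powr (- (real m + real DIM('a) - 2))"
    by (simp add: powr_add[symmetric] algebra_simps)
  finally show ?thesis .
qed

text \<open>The kernel is continuous with value 1 at \<open>e0\<close>. Elsewhere it can change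
  sign, so the lower bound is local.\<close>

lemma kelvin_ge_near_axis:
  fixes e0 e1 :: "'a::euclidean_space"
  assumes e: "e0 \<in> Basis" "e1 \<in> Basis" "e0 \<noteq> e1"
  obtains \<epsilon> where "0 < \<epsilon>" "\<And>w. dist w e0 < \<epsilon> \<Longrightarrow> 1 / 2 < kelvin e0 e1 m w"
proof -
  have "e0 \<noteq> 0" using e by auto
  then have "isCont (kelvin e0 e1 m) e0"
    unfolding kelvin_def planar_def by (intro continuous_intros) auto
  moreover have "kelvin e0 e1 m e0 = 1"
    using e by (simp add: kelvin_def planar_def inner_Basis)
  ultimately obtain \<epsilon> where \<epsilon>: "0 < \<epsilon>" "\<And>w. dist w e0 < \<epsilon> \<Longrightarrow> dist (kelvin e0 e1 m w) 1 < 1 / 2"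
    unfolding continuous_at_eps_delta by (metis zero_less_divide_1_iff zero_less_numeral)
  show thesis
  proof (rule that[OF \<epsilon>(1)])
    fix w assume "dist w e0 < \<epsilon>"
    from \<epsilon>(2)[OF this] show "1 / 2 < kelvin e0 e1 m w" unfolding dist_real_def by linarith
  qed
qed

section \<open>Test functions\<close>

declare borel_closed[OF closed_cball, measurable]

lemma borel_measurable_half_space_weight [measurable]:
  "(\<lambda>z. ennreal (snd z powr \<alpha>) * indicator half_space z) \<in> borel_measurable (borel :: ((real ^ 'n) \<times> real) measure)"
proof -
  have [measurable]: "(half_space :: ((real ^ 'n) \<times> real) set) \<in> sets borel"
    using open_half_space by (rule borel_open)
  have [measurable]: "snd \<in> borel_measurable (borel :: ((real ^ 'n) \<times> real) measure)"
    by (intro borel_measurable_continuous_onI continuous_intros)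
  show ?thesis by measurable
qed

section \<open>Integrals of the weight against powers of the distance\<close>

lemma nn_integral_powr_unit_interval:
  assumes "- 1 < \<alpha>"
  shows "(\<integral>\<^sup>+t\<in>{0..1}. ennreal (t powr \<alpha>) \<partial>lborel) = ennreal (1 / (\<alpha> + 1))"
proof -
  have "((\<lambda>t. t powr \<alpha>) has_integral 1 / (\<alpha> + 1)) {0..1::real}"
    using has_integral_powr_from_0[of \<alpha> 1] assms by simp
  then have "((\<lambda>t. if t \<in> {0..1} then t powr \<alpha> else 0) has_integral 1 / (\<alpha> + 1)) (UNIV :: real set)"
    by (simp only: has_integral_restrict_UNIV)
  then have "(\<integral>\<^sup>+t. ennreal (if t \<in> {0..1} then t powr \<alpha> else 0) \<partial>lborel) = ennreal (1 / (\<alpha> + 1))"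
    by (intro nn_integral_has_integral_lborel) auto
  also have "(\<integral>\<^sup>+t. ennreal (if t \<in> {0..1} then t powr \<alpha> else 0) \<partial>lborel)
      = (\<integral>\<^sup>+t\<in>{0..1}. ennreal (t powr \<alpha>) \<partial>lborel)"
    by (intro nn_integral_cong) (auto simp: indicator_def)
  finally show ?thesis .
qed

text \<open>The half ball sits in the product of a ball of R^n with [0, 1], and Tonelli reduces the
  claim to t^\<alpha> on [0, 1], integrable since \<alpha> > -1.\<close>

lemma nn_integral_weight_cball_finite:
  assumes \<alpha>: "- 1 < \<alpha>"
  shows "(\<integral>\<^sup>+z. ennreal (snd z powr \<alpha>) * indicator half_space z * indicator (cball (0 :: (real ^ 'n) \<times> real) 1) z \<partial>lborel) < \<infinity>"
proof -
  let ?g = "\<lambda>z :: (real ^ 'n) \<times> real. indicator (cball 0 1) (fst z) * (ennreal (snd z powr \<alpha>) * indicator {0..1} (snd z))"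
  have "(\<integral>\<^sup>+z. ennreal (snd z powr \<alpha>) * indicator half_space z * indicator (cball (0 :: (real ^ 'n) \<times> real) 1) z \<partial>lborel)
      \<le> (\<integral>\<^sup>+z. ?g z \<partial>lborel)"
  proof (rule nn_integral_mono)
    fix z :: "(real ^ 'n) \<times> real"
    show "ennreal (snd z powr \<alpha>) * indicator half_space z * indicator (cball 0 1) z \<le> ?g z"
      using norm_fst_le[of "fst z" "snd z"] norm_snd_le[of "snd z" "fst z"]
      by (auto simp: indicator_def mem_half_space)
  qed
  also have "\<dots> = (\<integral>\<^sup>+z. ?g z \<partial>(lborel \<Otimes>\<^sub>M lborel))" by (simp only: lborel_prod)
  also have "\<dots> = (\<integral>\<^sup>+x. \<integral>\<^sup>+t. ?g (x, t) \<partial>lborel \<partial>lborel)"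
  proof -
    have [measurable]: "(\<lambda>t. ennreal (t powr \<alpha>) * indicator {0..1} t) \<in> borel_measurable (lborel :: real measure)"
      by measurable
    have "?g \<in> borel_measurable (lborel \<Otimes>\<^sub>M lborel)"
      by (intro borel_measurable_times_ennreal
          measurable_compose[OF measurable_fst borel_measurable_indicator]
          measurable_compose[OF measurable_snd, of "\<lambda>t. ennreal (t powr \<alpha>) * indicator {0..1} t"]) auto
    from lborel.nn_integral_fst[OF this] show ?thesis by simp
  qed
  also have "\<dots> = (\<integral>\<^sup>+x. indicator (cball 0 1) (x :: real ^ 'n) * ennreal (1 / (\<alpha> + 1)) \<partial>lborel)"
    by (simp add: nn_integral_cmult nn_integral_powr_unit_interval[OF \<alpha>])
  also have "\<dots> = emeasure lborel (cball 0 1 :: (real ^ 'n) set) * ennreal (1 / (\<alpha> + 1))"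
    by (subst nn_integral_multc) auto
  also have "\<dots> < \<infinity>"
    using emeasure_lborel_cball_finite[of "0 :: real ^ 'n" 1] by (simp add: ennreal_mult_less_top)
  finally show ?thesis .
qed

lemma nn_integral_weight_cball_scale:
  fixes \<rho> \<alpha> :: real
  assumes \<rho>: "0 < \<rho>"
  shows "(\<integral>\<^sup>+z. ennreal (snd z powr \<alpha>) * indicator half_space z * indicator (cball (0 :: (real ^ 'n) \<times> real) \<rho>) z \<partial>lborel)
    = ennreal (\<rho> powr (real CARD('n) + 1 + \<alpha>)) *
      (\<integral>\<^sup>+z. ennreal (snd z powr \<alpha>) * indicator half_space z * indicator (cball (0 :: (real ^ 'n) \<times> real) 1) z \<partial>lborel)"
proof -
  let ?h = "\<lambda>z. ennreal (snd z powr \<alpha>) * indicator half_space z * indicator (cball (0 :: (real ^ 'n) \<times> real) \<rho>) z"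
  let ?k = "\<lambda>z. ennreal (snd z powr \<alpha>) * indicator half_space z * indicator (cball (0 :: (real ^ 'n) \<times> real) 1) z"
  have "(\<integral>\<^sup>+z. ?h z \<partial>lborel) = ennreal (\<bar>\<rho>\<bar> ^ DIM((real ^ 'n) \<times> real)) * (\<integral>\<^sup>+z. ?h (0 + \<rho> *\<^sub>R z) \<partial>lborel)"
    by (rule nn_integral_lborel_scale) (use \<rho> in auto)
  also have "(\<integral>\<^sup>+z. ?h (0 + \<rho> *\<^sub>R z) \<partial>lborel) = (\<integral>\<^sup>+z. ennreal (\<rho> powr \<alpha>) * ?k z \<partial>lborel)"
  proof (rule nn_integral_cong)
    fix z :: "(real ^ 'n) \<times> real"
    show "?h (0 + \<rho> *\<^sub>R z) = ennreal (\<rho> powr \<alpha>) * ?k z"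
      using \<rho> by (auto simp: indicator_def mem_half_space powr_mult ennreal_mult zero_less_mult_iff)
  qed
  also have "\<dots> = ennreal (\<rho> powr \<alpha>) * (\<integral>\<^sup>+z. ?k z \<partial>lborel)"
    by (rule nn_integral_cmult) measurable
  also have "ennreal (\<bar>\<rho>\<bar> ^ DIM((real ^ 'n) \<times> real)) * (ennreal (\<rho> powr \<alpha>) * x) = ennreal (\<rho> powr (real CARD('n) + 1 + \<alpha>)) * x" for x
  proof -
    have "\<bar>\<rho>\<bar> ^ DIM((real ^ 'n) \<times> real) * \<rho> powr \<alpha> = \<rho> powr (real CARD('n) + 1 + \<alpha>)"
      using \<rho> by (simp add: powr_add powr_realpow)
    then show ?thesis by (simp add: mult.assoc[symmetric] ennreal_mult[symmetric])
  qed
  finally show ?thesis .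
qed

text \<open>Both 1 and \<open>norm z\<close> are lower bounds, hence so is their average. The
  distance to the pole (0, -1) is thus controlled from below by 1 + |z|, which suits dyadic
  shells.\<close>

lemma norm_shift_ge:
  fixes z :: "(real ^ 'n) \<times> real"
  assumes "0 < snd z"
  shows "(1 + norm z) / 2 \<le> norm (z + (0, 1))"
proof -
  have "z + (0, 1) = (fst z, snd z + 1)" by (simp add: prod_eq_iff)
  then have "\<bar>snd z + 1\<bar> \<le> norm (z + (0, 1))"
    using norm_snd_le[of "snd z + 1" "fst z"] by simp
  then have 1: "1 \<le> norm (z + (0, 1))" using assms by simp
  have "norm z = sqrt ((norm (fst z))\<^sup>2 + (snd z)\<^sup>2)" by (simp add: norm_prod_def)
  also have "\<dots> \<le> sqrt ((norm (fst z))\<^sup>2 + (snd z + 1)\<^sup>2)"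
    using assms by (intro real_sqrt_le_mono add_left_mono power_mono) auto
  also have "\<dots> = norm (z + (0, 1))" by (simp add: norm_prod_def)
  finally have 2: "norm z \<le> norm (z + (0, 1))" .
  have "(1 + x) / 2 \<le> y" if "x \<le> y" "1 \<le> y" for x y :: real using that by simp
  then show ?thesis using 1 2 by blast
qed

lemma ex_dyadic_shell:
  fixes y :: real
  assumes "1 \<le> y"
  obtains k :: nat where "2 ^ k \<le> y" "y \<le> 2 ^ (k + 1)"
proof -
  define k where "k = nat \<lfloor>log 2 y\<rfloor>"
  have l: "real k \<le> log 2 y" "log 2 y \<le> real k + 1"
    using assms by (auto simp: k_def)
  have "2 powr real k \<le> y" "y \<le> 2 powr (real k + 1)"
    using assms l by (auto simp: le_log_iff log_le_iff)
  then show thesis by (intro that[of k]) (auto simp: powr_add powr_realpow)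
qed

text \<open>On the shell where 1 + |z| is about 2^k the decay factor is at most 2^(-(k-1)A), and the
  weight of the surrounding ball is 2^((k+1)s) times that of the unit ball, with s = n + 1 +
  \<alpha>. The series is geometric with ratio 2^(s-A) < 1.\<close>

lemma nn_integral_weight_decay_finite:
  fixes A \<alpha> :: real
  assumes \<alpha>: "- 1 < \<alpha>" and A: "real CARD('n) + 1 + \<alpha> < A"
  shows "(\<integral>\<^sup>+z. ennreal (norm (z + (0 :: real ^ 'n, 1)) powr (- A) * snd z powr \<alpha>) * indicator half_space z \<partial>lborel) < \<infinity>"
proof -
  define s where "s = real CARD('n) + 1 + \<alpha>"
  define wt :: "(real ^ 'n) \<times> real \<Rightarrow> ennreal" where "wt z = ennreal (snd z powr \<alpha>) * indicator half_space z" for z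
  define V where "V \<rho> = (\<integral>\<^sup>+z. wt z * indicator (cball 0 \<rho>) z \<partial>lborel)" for \<rho>
  define a where "a k = (2 ^ k / 2 :: real) powr (- A)" for k :: nat
  have [measurable]: "wt \<in> borel_measurable borel" unfolding wt_def by measurable
  have "(\<integral>\<^sup>+z. ennreal (norm (z + (0 :: real ^ 'n, 1)) powr (- A) * snd z powr \<alpha>) * indicator half_space z \<partial>lborel)
    \<le> (\<integral>\<^sup>+z. (\<Sum>k. ennreal (a k) * (wt z * indicator (cball 0 (2 ^ (k + 1))) z)) \<partial>lborel)"
  proof (rule nn_integral_mono)
    fix z :: "(real ^ 'n) \<times> real"
    show "ennreal (norm (z + (0, 1)) powr (- A) * snd z powr \<alpha>) * indicator half_space z
      \<le> (\<Sum>k. ennreal (a k) * (wt z * indicator (cball 0 (2 ^ (k + 1))) z))"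
    proof (cases "z \<in> half_space")
      case True
      obtain k where k: "2 ^ k \<le> 1 + norm z" "1 + norm z \<le> 2 ^ (k + 1)"
        using ex_dyadic_shell[of "1 + norm z"] by auto
      have "2 ^ k / 2 \<le> norm (z + (0, 1))"
        using k norm_shift_ge[of z] True by (simp add: mem_half_space)
      then have "norm (z + (0, 1)) powr (- A) \<le> a k"
        using A \<alpha> unfolding a_def by (intro powr_mono2') auto
      then have "ennreal (norm (z + (0, 1)) powr (- A) * snd z powr \<alpha>) \<le> ennreal (a k * snd z powr \<alpha>)"
        by (intro ennreal_leI mult_right_mono) auto
      also have "\<dots> = (\<Sum>k\<in>{k}. ennreal (a k) * (wt z * indicator (cball 0 (2 ^ (k + 1))) z))"
        using True k by (simp add: wt_def ennreal_mult a_def)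
      also have "\<dots> \<le> (\<Sum>k. ennreal (a k) * (wt z * indicator (cball 0 (2 ^ (k + 1))) z))"
        by (rule sum_le_suminf) auto
      finally show ?thesis using True by simp
    qed auto
  qed
  also have "\<dots> = (\<Sum>k. ennreal (a k) * V (2 ^ (k + 1)))"
    unfolding V_def by (subst nn_integral_suminf) (auto simp: nn_integral_cmult)
  also have "\<dots> = (\<Sum>k. ennreal (2 powr (A + s) * (2 powr (s - A)) ^ k) * V 1)"
  proof (intro suminf_cong)
    fix k
    have "V (2 ^ (k + 1)) = ennreal ((2 ^ (k + 1)) powr s) * V 1"
      unfolding V_def wt_def s_def by (rule nn_integral_weight_cball_scale) simp
    moreover have "a k * (2 ^ (k + 1)) powr s = 2 powr (A + s) * (2 powr (s - A)) ^ k"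
    proof -
      have "a k = 2 powr ((real k - 1) * (- A))"
      proof -
        have "(2::real) ^ k / 2 = 2 powr (real k - 1)" by (simp add: powr_diff powr_realpow)
        then show ?thesis unfolding a_def by (simp only: powr_powr)
      qed
      moreover have "((2::real) ^ (k + 1)) powr s = 2 powr ((real k + 1) * s)"
      proof -
        have "(2::real) ^ (k + 1) = 2 powr (real k + 1)" by (simp add: powr_add powr_realpow)
        then show ?thesis by (simp only: powr_powr)
      qed
      moreover have "((2::real) powr (s - A)) ^ k = 2 powr ((s - A) * real k)"
        by (simp add: powr_powr[symmetric] powr_realpow)
      ultimately show ?thesis by (simp add: powr_add[symmetric] algebra_simps)
    qed
    ultimately show "ennreal (a k) * V (2 ^ (k + 1)) = ennreal (2 powr (A + s) * (2 powr (s - A)) ^ k) * V 1"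
      by (simp add: mult.assoc[symmetric] ennreal_mult[symmetric] a_def)
  qed
  also have "\<dots> = (\<Sum>k. ennreal (2 powr (A + s) * (2 powr (s - A)) ^ k)) * V 1"
    by (simp add: ennreal_suminf_multc)
  also have "\<dots> < \<infinity>"
  proof -
    have "(2::real) powr (s - A) < 1" using A by (simp add: s_def powr_less_one)
    then have "summable (\<lambda>k. 2 powr (A + s) * (2 powr (s - A)) ^ k :: real)"
      by (intro summable_mult summable_geometric) simp
    then have "(\<Sum>k. ennreal (2 powr (A + s) * (2 powr (s - A)) ^ k)) \<noteq> top"
      by (rule ennreal_suminf_neq_top) simp
    moreover have "V 1 < \<infinity>"
      unfolding V_def wt_def by (rule nn_integral_weight_cball_finite[OF \<alpha>])
    ultimately show ?thesis by (simp add: ennreal_mult_less_top top.not_eq_extremum)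
  qed
  finally show ?thesis .
qed

text \<open>The substitution of (\<xi>, 0) + \<eta> z for z preserves the half space and moves the
  pole to (0, -1); the exponent collects n + 1 from the Jacobian, \<alpha> from the weight and -A
  from the kernel.\<close>

lemma nn_integral_weight_decay_scale:
  fixes A \<alpha> \<eta> :: real and \<xi> :: "real ^ 'n"
  assumes \<eta>: "0 < \<eta>"
  shows "(\<integral>\<^sup>+z. ennreal (norm (z - (\<xi>, - \<eta>)) powr (- A) * snd z powr \<alpha>) * indicator half_space z \<partial>lborel)
    = ennreal (\<eta> powr (real CARD('n) + 1 + \<alpha> - A)) *
      (\<integral>\<^sup>+z. ennreal (norm (z + (0 :: real ^ 'n, 1)) powr (- A) * snd z powr \<alpha>) * indicator half_space z \<partial>lborel)"
proof -
  let ?h = "\<lambda>z. ennreal (norm (z - (\<xi>, - \<eta>)) powr (- A) * snd z powr \<alpha>) * indicator half_space z"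
  let ?k = "\<lambda>z. ennreal (norm (z + (0 :: real ^ 'n, 1)) powr (- A) * snd z powr \<alpha>) * indicator half_space z"
  have meas: "(\<lambda>z. ennreal (norm (z - w) powr (- A) * snd z powr \<alpha>) * indicator half_space z) \<in> borel_measurable borel"
    for w :: "(real ^ 'n) \<times> real"
  proof -
    have "(\<lambda>z. ennreal (norm (z - w) powr (- A)) * (ennreal (snd z powr \<alpha>) * indicator half_space z)) \<in> borel_measurable borel"
      by measurable
    then show ?thesis by (simp add: ennreal_mult mult.assoc)
  qed
  have "(\<integral>\<^sup>+z. ?h z \<partial>lborel) = ennreal (\<bar>\<eta>\<bar> ^ DIM((real ^ 'n) \<times> real)) * (\<integral>\<^sup>+z. ?h ((\<xi>, 0) + \<eta> *\<^sub>R z) \<partial>lborel)"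
    by (rule nn_integral_lborel_scale[OF meas]) (use \<eta> in auto)
  also have "(\<integral>\<^sup>+z. ?h ((\<xi>, 0) + \<eta> *\<^sub>R z) \<partial>lborel) = (\<integral>\<^sup>+z. ennreal (\<eta> powr (\<alpha> - A)) * ?k z \<partial>lborel)"
  proof (rule nn_integral_cong)
    fix z :: "(real ^ 'n) \<times> real"
    have "(\<xi>, 0) + \<eta> *\<^sub>R z - (\<xi>, - \<eta>) = \<eta> *\<^sub>R (z + (0, 1))"
      by (simp add: prod_eq_iff algebra_simps)
    then have "norm ((\<xi>, 0) + \<eta> *\<^sub>R z - (\<xi>, - \<eta>)) = \<eta> * norm (z + (0, 1))" using \<eta> by simp
    then have "norm ((\<xi>, 0) + \<eta> *\<^sub>R z - (\<xi>, - \<eta>)) powr (- A) * snd ((\<xi>, 0) + \<eta> *\<^sub>R z) powr \<alpha>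
        = \<eta> powr (\<alpha> - A) * (norm (z + (0, 1)) powr (- A) * snd z powr \<alpha>)"
      by (simp add: powr_mult powr_diff powr_minus field_simps)
    then show "?h ((\<xi>, 0) + \<eta> *\<^sub>R z) = ennreal (\<eta> powr (\<alpha> - A)) * ?k z"
      using \<eta> by (simp add: ennreal_mult mem_half_space indicator_def zero_less_mult_iff)
  qed
  also have "\<dots> = ennreal (\<eta> powr (\<alpha> - A)) * (\<integral>\<^sup>+z. ?k z \<partial>lborel)"
  proof (rule nn_integral_cmult)
    have "z - (0, - 1) = z + (0, 1)" for z :: "(real ^ 'n) \<times> real" by (simp add: prod_eq_iff)
    with meas[of "(0, - 1)"] have "?k \<in> borel_measurable borel" by (simp only:)
    then show "?k \<in> borel_measurable lborel" by simp
  qed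
  also have "ennreal (\<bar>\<eta>\<bar> ^ DIM((real ^ 'n) \<times> real)) * (ennreal (\<eta> powr (\<alpha> - A)) * x) = ennreal (\<eta> powr (real CARD('n) + 1 + \<alpha> - A)) * x" for x
  proof -
    have "\<bar>\<eta>\<bar> ^ DIM((real ^ 'n) \<times> real) * \<eta> powr (\<alpha> - A) = \<eta> powr (real CARD('n) + 1 + (\<alpha> - A))"
      using \<eta> by (simp add: powr_add powr_realpow)
    then show ?thesis by (simp add: mult.assoc[symmetric] ennreal_mult[symmetric] add_diff_eq)
  qed
  finally show ?thesis .
qed

text \<open>The kernel is translated so that its pole is (\<xi>, -\<eta>), the reflection of the
  centre. Both bounds carry the same factor \<eta>^(-\<gamma>), which cancels when they are
  compared; the size of \<gamma> matters for the convergence of the integral.\<close>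

lemma bergman_test_functions:
  fixes p \<alpha> :: real
  assumes p: "0 < p" and \<alpha>: "- 1 < \<alpha>"
  obtains \<epsilon> B c \<gamma> :: real where "0 < \<epsilon>" "\<epsilon> \<le> 1 / 2" "0 < B" "0 < c"
    "\<And>(\<xi> :: real ^ 'n) \<eta>. 0 < \<eta> \<Longrightarrow> \<exists>f. harmonic_on f half_space \<and>
      (\<integral>\<^sup>+z\<in>half_space. ennreal (\<bar>f z\<bar> powr p * snd z powr \<alpha>) \<partial>lborel)
        \<le> ennreal (B * \<eta> powr (real CARD('n) + 1 + \<alpha> - \<gamma>)) \<and>
      (\<forall>z\<in>cball (\<xi>, \<eta>) (\<epsilon> * \<eta>). c * \<eta> powr (- \<gamma>) \<le> \<bar>f z\<bar> powr p)"
proof -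
  let ?d = "real CARD('n) + 1"
  \<comment> \<open>\<open>e0\<close> points upwards because centre minus pole is 2 \<eta> times
    \<open>e0\<close>; \<open>e1\<close> is an arbitrary horizontal basis vector.\<close>
  define e0 :: "(real ^ 'n) \<times> real" where "e0 = (0, 1)"
  define e1 :: "(real ^ 'n) \<times> real" where "e1 = (axis undefined 1, 0)"
  have e: "e0 \<in> Basis" "e1 \<in> Basis" "e0 \<noteq> e1"
    by (auto simp: e0_def e1_def Basis_prod_def)
  \<comment> \<open>Forces \<gamma> = M p > n + 1 + \<alpha>, since M = m0 + n. Taking
    \<open>m\<close> one larger than \<open>m0\<close> also guarantees m >= 1.\<close>
  obtain m0 :: nat where m0: "(?d + \<alpha>) / p < m0" using reals_Archimedean2 by blast
  define m where "m = m0 + 1"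
  define M where "M = real m + ?d - 2"
  define \<gamma> where "\<gamma> = M * p"
  have DIM: "real DIM((real ^ 'n) \<times> real) = ?d" by simp
  have \<gamma>: "?d + \<alpha> < \<gamma>"
  proof -
    have "?d + \<alpha> < m0 * p" using m0 p by (simp add: field_simps)
    also have "\<dots> \<le> M * p" using p by (intro mult_right_mono) (auto simp: M_def m_def)
    finally show ?thesis by (simp add: \<gamma>_def)
  qed
  obtain \<epsilon>0 where \<epsilon>0: "0 < \<epsilon>0" and near: "\<And>w. dist w e0 < \<epsilon>0 \<Longrightarrow> 1 / 2 < kelvin e0 e1 m w"
    using kelvin_ge_near_axis[OF e] by metis
  define \<epsilon> where "\<epsilon> = min (1 / 2) \<epsilon>0"
  define J where "J = (\<integral>\<^sup>+z. ennreal (norm (z + (0 :: real ^ 'n, 1)) powr (- \<gamma>) * snd z powr \<alpha>) * indicator half_space z \<partial>lborel)"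
  have "J < \<infinity>" unfolding J_def by (rule nn_integral_weight_decay_finite[OF \<alpha> \<gamma>])
  then obtain B0 where B0: "0 \<le> B0" "J = ennreal B0" by (cases J) auto
  define c where "c = (2 powr (- M) / 2) powr p"
  show thesis
  \<comment> \<open>\<open>B0\<close> is known to be nonnegative; adding 1 makes the constant
    positive.\<close>
  proof (rule that[of \<epsilon> "B0 + 1" c \<gamma>])
    show "0 < \<epsilon>" "\<epsilon> \<le> 1 / 2" "0 < B0 + 1" "0 < c" using \<epsilon>0 B0 by (auto simp: \<epsilon>_def c_def)
    fix \<xi> :: "real ^ 'n" and \<eta> :: real assume \<eta>: "0 < \<eta>"
    define f where "f z = kelvin e0 e1 m (z - (\<xi>, - \<eta>))" for z
    have f_le: "\<bar>f z\<bar> powr p \<le> norm (z - (\<xi>, - \<eta>)) powr (- \<gamma>)" for z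
    proof -
      have "\<bar>f z\<bar> powr p \<le> (norm (z - (\<xi>, - \<eta>)) powr (- M)) powr p"
        using abs_kelvin_le[OF e, of m "z - (\<xi>, - \<eta>)"] p unfolding f_def DIM M_def
        by (intro powr_mono2) auto
      then show ?thesis by (simp add: powr_powr \<gamma>_def)
    qed
    have "harmonic_on f half_space"
      unfolding f_def using \<eta>
      by (intro harmonic_on_kelvin e open_half_space) (auto simp: m_def mem_half_space)
    moreover have "(\<integral>\<^sup>+z\<in>half_space. ennreal (\<bar>f z\<bar> powr p * snd z powr \<alpha>) \<partial>lborel)
        \<le> ennreal ((B0 + 1) * \<eta> powr (real CARD('n) + 1 + \<alpha> - \<gamma>))"
    proof -
      have "(\<integral>\<^sup>+z\<in>half_space. ennreal (\<bar>f z\<bar> powr p * snd z powr \<alpha>) \<partial>lborel)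
        \<le> (\<integral>\<^sup>+z. ennreal (norm (z - (\<xi>, - \<eta>)) powr (- \<gamma>) * snd z powr \<alpha>) * indicator half_space z \<partial>lborel)"
        using f_le by (intro nn_integral_mono mult_right_mono ennreal_leI) auto
      also have "\<dots> = ennreal (\<eta> powr (real CARD('n) + 1 + \<alpha> - \<gamma>)) * ennreal B0"
        using nn_integral_weight_decay_scale[OF \<eta>, of \<xi> \<gamma> \<alpha>] B0 by (simp add: J_def)
      also have "\<dots> \<le> ennreal ((B0 + 1) * \<eta> powr (real CARD('n) + 1 + \<alpha> - \<gamma>))"
        using B0 by (subst ennreal_mult[symmetric]) (auto intro!: ennreal_leI simp: algebra_simps)
      finally show ?thesis .
    qed
    moreover have "c * \<eta> powr (- \<gamma>) \<le> \<bar>f z\<bar> powr p" if z: "z \<in> cball (\<xi>, \<eta>) (\<epsilon> * \<eta>)" for z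
    proof -
      \<comment> \<open>Coordinates in which the pole is 0 and the centre is \<open>e0\<close>; a
        displacement of at most \<epsilon> \<eta> becomes at most \<epsilon> / 2.\<close>
      define w where "w = (1 / (2 * \<eta>)) *\<^sub>R (z - (\<xi>, - \<eta>))"
      have zw: "z - (\<xi>, - \<eta>) = (2 * \<eta>) *\<^sub>R w" using \<eta> by (simp add: w_def)
      have "w - e0 = (1 / (2 * \<eta>)) *\<^sub>R (z - (\<xi>, \<eta>))"
        using \<eta> by (simp add: w_def e0_def prod_eq_iff field_simps)
      then have "dist w e0 = dist z (\<xi>, \<eta>) / (2 * \<eta>)"
        using \<eta> by (simp add: dist_norm)
      also have "\<dots> \<le> \<epsilon> / 2" using z \<eta> by (simp add: dist_commute field_simps)
      also have "\<dots> < \<epsilon>0" using \<epsilon>0 by (auto simp: \<epsilon>_def)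
      finally have "1 / 2 < kelvin e0 e1 m w" by (rule near)
      moreover have "f z = (2 * \<eta>) powr (- M) * kelvin e0 e1 m w"
        unfolding f_def zw using \<eta> by (subst kelvin_scale) (auto simp: M_def)
      moreover have "(2 * \<eta>) powr (- M) * (1 / 2) \<le> (2 * \<eta>) powr (- M) * kelvin e0 e1 m w"
        using calculation by (intro mult_left_mono) auto
      ultimately have "(2 * \<eta>) powr (- M) * (1 / 2) \<le> \<bar>f z\<bar>" by linarith
      then have "((2 powr (- M) / 2) * \<eta> powr (- M)) powr p \<le> \<bar>f z\<bar> powr p"
        using p by (intro powr_mono2) (auto simp: powr_mult)
      then show ?thesis unfolding c_def \<gamma>_def mult_minus_left[symmetric]
        by (simp only: powr_mult[of _ "\<eta> powr (- M)"] powr_powr)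
    qed
    ultimately show "\<exists>f. harmonic_on f half_space \<and>
      (\<integral>\<^sup>+z\<in>half_space. ennreal (\<bar>f z\<bar> powr p * snd z powr \<alpha>) \<partial>lborel)
        \<le> ennreal ((B0 + 1) * \<eta> powr (real CARD('n) + 1 + \<alpha> - \<gamma>)) \<and>
      (\<forall>z\<in>cball (\<xi>, \<eta>) (\<epsilon> * \<eta>). c * \<eta> powr (- \<gamma>) \<le> \<bar>f z\<bar> powr p)" by blast
  qed
qed

section \<open>The embedding\<close>

lemma epowr_ennreal: "0 \<le> x \<Longrightarrow> epowr (ennreal x) a = ennreal (x powr a)"
  by (simp add: epowr_def)

lemma epowr_top: "epowr top a = top"
  by (simp add: epowr_def)

lemma epowr_mono: "x \<le> y \<Longrightarrow> 0 \<le> a \<Longrightarrow> epowr x a \<le> epowr y a"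
  by (cases x; cases y) (auto simp: epowr_ennreal epowr_top top_unique intro!: ennreal_leI powr_mono2)

lemma epowr_epowr: "epowr (epowr x a) b = epowr x (a * b)"
  by (cases x) (auto simp: epowr_ennreal epowr_top powr_powr)

lemma epowr_one [simp]: "epowr x 1 = x"
  by (cases x) (auto simp: epowr_ennreal epowr_top)

lemma epowr_cmult: "0 < C \<Longrightarrow> epowr (ennreal C * x) a = ennreal (C powr a) * epowr x a"
  by (cases x) (auto simp: epowr_ennreal epowr_top ennreal_mult[symmetric] powr_mult ennreal_mult_top)

lemma epowr_less_top_iff: "epowr x a < top \<longleftrightarrow> x < top"
  by (cases x) (auto simp: epowr_ennreal epowr_top)

text \<open>The embedding of l^1 into l^s: each term is at most A, so its s-th power is at most a_k
  A^(s-1), and summing gives A^s. Finite partial sums suffice, as the infinite sum is their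
  supremum.\<close>

lemma infsum_epowr_le:
  fixes a :: "'i \<Rightarrow> ennreal"
  assumes s: "1 \<le> s" and le: "\<And>F. finite F \<Longrightarrow> sum a F \<le> A"
  shows "(\<Sum>\<^sub>\<infinity>k. epowr (a k) s) \<le> epowr A s"
proof (cases A)
  case top
  then show ?thesis by (simp add: epowr_top)
next
  case (real x)
  have "sum (\<lambda>k. epowr (a k) s) F \<le> epowr A s" if F: "finite F" for F
  proof -
    define y where "y k = enn2real (a k)" for k
    have "a k \<le> A" for k using le[of "{k}"] by simp
    then have a: "a k = ennreal (y k)" for k
      using real by (metis ennreal_enn2real_if ennreal_less_top leD y_def infinity_ennreal_def)
    have y: "0 \<le> y k" for k by (simp add: y_def)
    have "ennreal (sum y F) = sum a F" by (simp add: a y)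
    with le[OF F] real have "ennreal (sum y F) \<le> ennreal x" by (simp only:)
    then have sum: "sum y F \<le> x" using real by (simp only: ennreal_le_iff)
    have "sum (\<lambda>k. y k powr s) F \<le> (\<Sum>k\<in>F. y k * x powr (s - 1))"
    proof (rule sum_mono)
      fix k assume "k \<in> F"
      then have "y k \<le> x" using sum member_le_sum[of k F y] F y by simp
      then have "y k powr (s - 1) \<le> x powr (s - 1)" using y s by (intro powr_mono2) auto
      then show "y k powr s \<le> y k * x powr (s - 1)"
        using y[of k] by (cases "y k = 0") (auto simp: powr_diff field_simps)
    qed
    also have "\<dots> \<le> x * x powr (s - 1)"
      using sum by (simp add: sum_distrib_right[symmetric] mult_right_mono)
    also have "\<dots> = x powr s" using real by (cases "x = 0") (auto simp: powr_diff)
    finally have "ennreal (sum (\<lambda>k. y k powr s) F) \<le> ennreal (x powr s)" by (rule ennreal_leI)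
    then show ?thesis using real y by (simp add: a epowr_ennreal)
  qed
  then show ?thesis by (subst nonneg_infsum_complete) (auto intro!: SUP_least)
qed

lemma le_infsum_ennreal: "(f k :: ennreal) \<le> (\<Sum>\<^sub>\<infinity>k. f k)"
  by (subst nonneg_infsum_complete) (auto intro!: SUP_upper2[of "{k}"])

lemma ennreal_divide_le_iff:
  assumes "0 < x" "0 \<le> C"
  shows "y / ennreal x \<le> ennreal C \<longleftrightarrow> y \<le> ennreal (C * x)"
  using assms by (cases y) (auto simp: divide_ennreal pos_divide_le_eq ennreal_top_divide top_unique)

lemma ennreal_mult_leD:
  assumes "ennreal c * x \<le> ennreal y" "0 < c" "0 \<le> y"
  shows "x \<le> ennreal (y / c)"
  using assms
  by (cases x) (auto simp: ennreal_mult[symmetric] pos_le_divide_eq mult.commute ennreal_mult_top top_unique)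

section \<open>Dyadic layers and the norm built from them\<close>

text \<open>In logarithmic form a point of positive height t visibly lies in exactly one layer, with
  index -floor(log2 t) - 1; disjointness and covering are both read off from this.\<close>

lemma mem_layer_iff: "z \<in> layer k \<longleftrightarrow> 0 < snd z \<and> \<lfloor>log 2 (snd z)\<rfloor> = - k - 1"
proof -
  have pw: "(2::real) powi i = 2 powr (real_of_int i)" for i by (simp add: powr_real_of_int')
  have "z \<in> layer k \<longleftrightarrow> 2 powr (real_of_int (- k - 1)) \<le> snd z \<and> snd z < 2 powr (real_of_int (- k))"
    by (cases z) (simp only: layer_def pw mem_Times_iff fst_conv snd_conv atLeastLessThan_iff UNIV_I simp_thms)
  also have "\<dots> \<longleftrightarrow> 0 < snd z \<and> real_of_int (- k - 1) \<le> log 2 (snd z) \<and> log 2 (snd z) < real_of_int (- k)"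
  proof (cases "0 < snd z")
    case True
    then show ?thesis by (simp add: le_log_iff log_less_iff)
  next
    case False
    then show ?thesis by (smt (verit) powr_gt_zero)
  qed
  also have "\<dots> \<longleftrightarrow> 0 < snd z \<and> \<lfloor>log 2 (snd z)\<rfloor> = - k - 1"
    by (auto simp: floor_eq_iff)
  finally show ?thesis .
qed

lemma layer_borel [measurable]: "layer k \<in> sets (borel :: ((real ^ 'n) \<times> real) measure)"
  unfolding layer_def by (intro borel_Times) auto

lemma layer_subset_half_space: "layer k \<subseteq> half_space"
  by (auto simp: mem_layer_iff mem_half_space)

lemma K_norm_le:
  fixes \<mu> :: "((real ^ 'n) \<times> real) measure"
  assumes p: "0 < p" "p \<le> q" and \<mu>: "sets \<mu> = sets (restrict_space borel half_space)"
    and f: "continuous_on half_space f"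
  shows "K_norm \<mu> p q f \<le> epowr (\<integral>\<^sup>+z\<in>half_space. ennreal (\<bar>f z\<bar> powr p) \<partial>\<mu>) (1 / p)"
proof -
  let ?g = "\<lambda>z. ennreal (\<bar>f z\<bar> powr p)"
  have g: "?g \<in> borel_measurable \<mu>"
    using borel_measurable_half_space_restrict[OF \<mu> continuous_on_abs_powr[OF f p(1)]] by measurable
  have lay: "layer k \<in> sets \<mu>" for k
    using layer_subset_half_space by (simp add: sets_half_space_restrict[OF \<mu>])
  have "(\<Sum>\<^sub>\<infinity>k::int. epowr (\<integral>\<^sup>+z\<in>layer k. ?g z \<partial>\<mu>) (q / p)) \<le> epowr (\<integral>\<^sup>+z\<in>half_space. ?g z \<partial>\<mu>) (q / p)"
  proof (rule infsum_epowr_le)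
    fix F :: "int set" assume F: "finite F"
    have "(\<Sum>k\<in>F. \<integral>\<^sup>+z\<in>layer k. ?g z \<partial>\<mu>) = (\<integral>\<^sup>+z. (\<Sum>k\<in>F. ?g z * indicator (layer k) z) \<partial>\<mu>)"
      using g lay by (intro nn_integral_sum[symmetric]) auto
    also have "\<dots> \<le> (\<integral>\<^sup>+z\<in>half_space. ?g z \<partial>\<mu>)"
    proof (rule nn_integral_mono)
      fix z :: "(real ^ 'n) \<times> real"
      \<comment> \<open>The only index whose layer can contain \<open>z\<close>, so the finite sum
        has at most this one nonzero term.\<close>
      define i where "i = - \<lfloor>log 2 (snd z)\<rfloor> - 1"
      have "(\<Sum>k\<in>F. ?g z * indicator (layer k) z) = (\<Sum>k\<in>F. if k = i then ?g z * indicator (layer i) z else 0)"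
        by (intro sum.cong refl) (auto simp: indicator_def mem_layer_iff i_def)
      also have "\<dots> \<le> ?g z * indicator half_space z"
        using F layer_subset_half_space[of i] by (auto simp: indicator_def)
      finally show "(\<Sum>k\<in>F. ?g z * indicator (layer k) z) \<le> ?g z * indicator half_space z" .
    qed
    finally show "(\<Sum>k\<in>F. \<integral>\<^sup>+z\<in>layer k. ?g z \<partial>\<mu>) \<le> (\<integral>\<^sup>+z\<in>half_space. ?g z \<partial>\<mu>)" .
  qed (use p in simp)
  then have "K_norm \<mu> p q f \<le> epowr (epowr (\<integral>\<^sup>+z\<in>half_space. ?g z \<partial>\<mu>) (q / p)) (1 / q)"
    unfolding K_norm_def using p by (intro epowr_mono) auto
  also have "\<dots> = epowr (\<integral>\<^sup>+z\<in>half_space. ?g z \<partial>\<mu>) (1 / p)"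
    using p by (simp add: epowr_epowr)
  finally show ?thesis .
qed

text \<open>A single term is bounded by the whole sum, and the exponents multiply to (q/p) (1/q) p =
  1.\<close>

lemma layer_integral_le_K_norm:
  assumes p: "0 < p" "p \<le> q"
  shows "(\<integral>\<^sup>+z\<in>layer k. ennreal (\<bar>f z\<bar> powr p) \<partial>\<mu>) \<le> epowr (K_norm \<mu> p q f) p"
proof -
  let ?a = "\<lambda>k. \<integral>\<^sup>+z\<in>layer k. ennreal (\<bar>f z\<bar> powr p) \<partial>\<mu>"
  have "epowr (?a k) (q / p) \<le> (\<Sum>\<^sub>\<infinity>k::int. epowr (?a k) (q / p))"
    by (rule le_infsum_ennreal)
  then have "epowr (epowr (epowr (?a k) (q / p)) (1 / q)) p \<le> epowr (K_norm \<mu> p q f) p"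
    unfolding K_norm_def using p by (intro epowr_mono) auto
  then show ?thesis using p by (simp add: epowr_epowr)
qed

section \<open>The two implications\<close>

lemma carleson_imp_K_embedding:
  fixes \<mu> :: "((real ^ 'n) \<times> real) measure"
  assumes p: "0 < p" "p \<le> q" and \<mu>: "sets \<mu> = sets (restrict_space borel half_space)" and C: "0 < C"
    and le: "\<And>f. harmonic_on f half_space \<Longrightarrow> (\<integral>\<^sup>+z\<in>half_space. ennreal (\<bar>f z\<bar> powr p) \<partial>\<mu>)
      \<le> ennreal C * (\<integral>\<^sup>+z\<in>half_space. ennreal (\<bar>f z\<bar> powr p * snd z powr \<alpha>) \<partial>lborel)"
    and f: "f \<in> bergman_space p \<alpha>"
  shows "f \<in> K_space \<mu> p q \<and> K_norm \<mu> p q f \<le> ennreal (C powr (1 / p)) * bergman_norm p \<alpha> f"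
proof -
  have harm: "harmonic_on f half_space" and fin: "bergman_norm p \<alpha> f < \<infinity>"
    using f by (auto simp: bergman_space_def)
  have "K_norm \<mu> p q f \<le> epowr (\<integral>\<^sup>+z\<in>half_space. ennreal (\<bar>f z\<bar> powr p) \<partial>\<mu>) (1 / p)"
    by (rule K_norm_le[OF p \<mu> harmonic_on_continuous[OF harm open_half_space]])
  also have "\<dots> \<le> epowr (ennreal C * (\<integral>\<^sup>+z\<in>half_space. ennreal (\<bar>f z\<bar> powr p * snd z powr \<alpha>) \<partial>lborel)) (1 / p)"
    using p by (intro epowr_mono le harm) auto
  also have "\<dots> = ennreal (C powr (1 / p)) * bergman_norm p \<alpha> f"
    unfolding bergman_norm_def by (rule epowr_cmult[OF C])
  finally have le: "K_norm \<mu> p q f \<le> ennreal (C powr (1 / p)) * bergman_norm p \<alpha> f" .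
  also have "\<dots> < \<infinity>" using fin by (simp add: ennreal_mult_less_top)
  finally have "f \<in> K_space \<mu> p q" using harm by (simp add: K_space_def)
  with le show ?thesis by blast
qed

text \<open>On the ball the test function satisfies |f|^p >= c \<eta>^(-\<gamma>), while the p-th
  power of its Bergman norm is at most B \<eta>^(n+1+\<alpha>-\<gamma>); dividing leaves the
  required power of \<eta>. The ball is cut along the layers because each layer is a single term of
  the K-norm, for which the exponent q/p can be undone.\<close>

lemma K_embedding_imp_ball_bound:
  fixes \<mu> :: "((real ^ 'n) \<times> real) measure"
  assumes p: "0 < p" "p \<le> q" and \<alpha>: "- 1 < \<alpha>" and \<mu>: "sets \<mu> = sets (restrict_space borel half_space)"
    and C: "0 < C" and emb: "\<forall>f\<in>bergman_space p \<alpha>. K_norm \<mu> p q f \<le> ennreal C * bergman_norm p \<alpha> f"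
  obtains \<epsilon> L where "0 < \<epsilon>" "\<epsilon> \<le> 1 / 2" "0 < L"
    "\<forall>(\<xi> :: real ^ 'n). \<forall>\<eta>>0.
      emeasure \<mu> (cball (\<xi>, \<eta>) (\<epsilon> * \<eta>)) \<le> ennreal (L * \<eta> powr (real CARD('n) + 1 + \<alpha>))"
proof -
  obtain \<epsilon> B c \<gamma> :: real where \<epsilon>: "0 < \<epsilon>" "\<epsilon> \<le> 1 / 2" and B: "0 < B" and c: "0 < c"
    and test: "\<And>(\<xi> :: real ^ 'n) \<eta>. 0 < \<eta> \<Longrightarrow> \<exists>f. harmonic_on f half_space \<and>
      (\<integral>\<^sup>+z\<in>half_space. ennreal (\<bar>f z\<bar> powr p * snd z powr \<alpha>) \<partial>lborel)
        \<le> ennreal (B * \<eta> powr (real CARD('n) + 1 + \<alpha> - \<gamma>)) \<and>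
      (\<forall>z\<in>cball (\<xi>, \<eta>) (\<epsilon> * \<eta>). c * \<eta> powr (- \<gamma>) \<le> \<bar>f z\<bar> powr p)"
    by (fact bergman_test_functions[OF p(1) \<alpha>])
  define L0 where "L0 = C powr p * B / c"
  show thesis
  \<comment> \<open>\<open>L0\<close> bounds the part of the ball in one layer, and 3 counts the
    layers.\<close>
  proof (rule that[of \<epsilon> "3 * L0"])
    show "0 < 3 * L0" using B C c by (simp add: L0_def)
    show "\<forall>(\<xi> :: real ^ 'n). \<forall>\<eta>>0.
      emeasure \<mu> (cball (\<xi>, \<eta>) (\<epsilon> * \<eta>)) \<le> ennreal (3 * L0 * \<eta> powr (real CARD('n) + 1 + \<alpha>))"
    proof (intro allI impI)
      fix \<xi> :: "real ^ 'n" and \<eta> :: real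
      assume \<eta>: "0 < \<eta>"
      let ?B = "cball (\<xi>, \<eta>) (\<epsilon> * \<eta>)"
      obtain f where harm: "harmonic_on f half_space"
        and I: "(\<integral>\<^sup>+z\<in>half_space. ennreal (\<bar>f z\<bar> powr p * snd z powr \<alpha>) \<partial>lborel)
          \<le> ennreal (B * \<eta> powr (real CARD('n) + 1 + \<alpha> - \<gamma>))"
        and low: "\<And>z. z \<in> ?B \<Longrightarrow> c * \<eta> powr (- \<gamma>) \<le> \<bar>f z\<bar> powr p"
        using test[OF \<eta>] by blast
      have height: "\<eta> / 2 \<le> snd z \<and> snd z < 2 * \<eta>" if "z \<in> ?B" for z
      proof -
        have "\<bar>\<eta> - snd z\<bar> \<le> \<epsilon> * \<eta>" using that dist_snd_le[of "(\<xi>, \<eta>)" z] by (auto simp: dist_real_def)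
        moreover have "\<epsilon> * \<eta> \<le> 1 / 2 * \<eta>" using \<epsilon> \<eta> by (intro mult_right_mono) auto
        ultimately show ?thesis using \<eta> by linarith
      qed
      have sets: "?B \<inter> layer k \<in> sets \<mu>" for k
        unfolding sets_half_space_restrict[OF \<mu>] using layer_subset_half_space[of k] by auto
      have part: "emeasure \<mu> (?B \<inter> layer k) \<le> ennreal (L0 * \<eta> powr (real CARD('n) + 1 + \<alpha>))" for k
      proof -
        have f: "f \<in> bergman_space p \<alpha>"
        proof -
          have "(\<integral>\<^sup>+z\<in>half_space. ennreal (\<bar>f z\<bar> powr p * snd z powr \<alpha>) \<partial>lborel) < top"
            using I by (rule order_le_less_trans) simp
          then show ?thesis using harm by (simp add: bergman_space_def bergman_norm_def epowr_less_top_iff)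
        qed
        have "ennreal (c * \<eta> powr (- \<gamma>)) * emeasure \<mu> (?B \<inter> layer k)
            = (\<integral>\<^sup>+z. ennreal (c * \<eta> powr (- \<gamma>)) * indicator (?B \<inter> layer k) z \<partial>\<mu>)"
          using sets by (rule nn_integral_cmult_indicator[symmetric])
        also have "\<dots> \<le> (\<integral>\<^sup>+z\<in>layer k. ennreal (\<bar>f z\<bar> powr p) \<partial>\<mu>)"
          using low by (intro nn_integral_mono) (auto simp: indicator_def intro!: ennreal_leI)
        also have "\<dots> \<le> epowr (K_norm \<mu> p q f) p" by (rule layer_integral_le_K_norm[OF p])
        also have "\<dots> \<le> epowr (ennreal C * bergman_norm p \<alpha> f) p"
          using p emb f by (intro epowr_mono) auto
        also have "\<dots> = ennreal (C powr p) * (\<integral>\<^sup>+z\<in>half_space. ennreal (\<bar>f z\<bar> powr p * snd z powr \<alpha>) \<partial>lborel)"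
          using p C by (simp add: epowr_cmult bergman_norm_def epowr_epowr)
        also have "\<dots> \<le> ennreal (C powr p) * ennreal (B * \<eta> powr (real CARD('n) + 1 + \<alpha> - \<gamma>))"
          by (intro mult_left_mono I) auto
        also have "\<dots> = ennreal (C powr p * (B * \<eta> powr (real CARD('n) + 1 + \<alpha> - \<gamma>)))"
          using B by (intro ennreal_mult[symmetric]) auto
        finally have "emeasure \<mu> (?B \<inter> layer k)
          \<le> ennreal (C powr p * (B * \<eta> powr (real CARD('n) + 1 + \<alpha> - \<gamma>)) / (c * \<eta> powr (- \<gamma>)))"
          using B c \<eta> by (intro ennreal_mult_leD) auto
        also have "C powr p * (B * \<eta> powr (real CARD('n) + 1 + \<alpha> - \<gamma>)) / (c * \<eta> powr (- \<gamma>))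
          = L0 * \<eta> powr (real CARD('n) + 1 + \<alpha>)"
          using \<eta> c by (simp add: L0_def powr_diff powr_minus field_simps)
        finally show ?thesis .
      qed
      \<comment> \<open>Heights in [\<eta> / 2, 2 \<eta>) change the floor of the logarithm by at
        most 1, so it takes the values k0 - 1, k0, k0 + 1; the shift in the layer index turns these
        into the range from -k0 - 2 to -k0.\<close>
      define k0 where "k0 = \<lfloor>log 2 \<eta>\<rfloor>"
      have "?B = (\<Union>k\<in>{- k0 - 2..- k0}. ?B \<inter> layer k)"
      proof -
        have "\<exists>k\<in>{- k0 - 2..- k0}. z \<in> layer k" if z: "z \<in> ?B" for z
        proof -
          have s: "0 < snd z" using height[OF z] \<eta> by linarith
          have "log 2 (\<eta> / 2) \<le> log 2 (snd z)" "log 2 (snd z) < log 2 (2 * \<eta>)"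
            using height[OF z] \<eta> s by auto
          then have "log 2 \<eta> - 1 \<le> log 2 (snd z)" "log 2 (snd z) < log 2 \<eta> + 1"
            using \<eta> by (auto simp: log_divide log_mult)
          then have "k0 - 1 \<le> \<lfloor>log 2 (snd z)\<rfloor>" "\<lfloor>log 2 (snd z)\<rfloor> \<le> k0 + 1"
            unfolding k0_def by linarith+
          then show ?thesis using s by (intro bexI[of _ "- \<lfloor>log 2 (snd z)\<rfloor> - 1"]) (auto simp: mem_layer_iff)
        qed
        then show ?thesis by blast
      qed
      then have "emeasure \<mu> ?B = emeasure \<mu> (\<Union>k\<in>{- k0 - 2..- k0}. ?B \<inter> layer k)" by simp
      also have "\<dots> \<le> (\<Sum>k\<in>{- k0 - 2..- k0}. emeasure \<mu> (?B \<inter> layer k))"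
        using sets by (intro emeasure_subadditive_finite) auto
      also have "\<dots> \<le> (\<Sum>k\<in>{- k0 - 2..- k0}. ennreal (L0 * \<eta> powr (real CARD('n) + 1 + \<alpha>)))"
        by (intro sum_mono part)
      also have "\<dots> = ennreal (3 * L0 * \<eta> powr (real CARD('n) + 1 + \<alpha>))"
      proof -
        have "0 \<le> L0 * \<eta> powr (real CARD('n) + 1 + \<alpha>)" using B C c by (simp add: L0_def)
        then show ?thesis by (simp add: ennreal_mult' mult.assoc)
      qed
      finally show "emeasure \<mu> ?B \<le> ennreal (3 * L0 * \<eta> powr (real CARD('n) + 1 + \<alpha>))" .
    qed
  qed (use \<epsilon> in auto)
qed

text \<open>After scaling to the unit cube one finite cover serves all Whitney cubes, so the number
  of balls does not depend on j. Points of the cube have height at least \<kappa> \<eta>_j, hence a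
  scaled ball of radius at most \<kappa> \<epsilon> \<eta>_j lies in the ball with the same centre
  to which the assumed bound applies.\<close>

lemma ball_bound_imp_whitney_bound:
  fixes \<mu> :: "((real ^ 'n) \<times> real) measure" and \<Delta> :: "nat \<Rightarrow> ((real ^ 'n) \<times> real) set"
  assumes \<alpha>: "- 1 < \<alpha>" and \<mu>: "sets \<mu> = sets (restrict_space borel half_space)"
    and W: "whitney_decomposition \<Delta>" and \<epsilon>: "0 < \<epsilon>" "\<epsilon> \<le> 1 / 2" and L: "0 < L"
    and ball: "\<forall>(\<xi> :: real ^ 'n). \<forall>\<eta>>0.
      emeasure \<mu> (cball (\<xi>, \<eta>) (\<epsilon> * \<eta>)) \<le> ennreal (L * \<eta> powr (real CARD('n) + 1 + \<alpha>))"
  obtains K where "0 < K"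
    "\<And>j. emeasure \<mu> (\<Delta> j) \<le> ennreal (K * measure lborel (\<Delta> j) powr (1 + \<alpha> / (real CARD('n) + 1)))"
proof -
  define s where "s = real CARD('n) + 1 + \<alpha>"
  have s: "0 < s" using \<alpha> by (simp add: s_def add_pos_nonneg)
  obtain \<kappa> c r where \<kappa>: "0 < \<kappa>" "\<kappa> \<le> 1" and \<Delta>: "\<And>j. \<Delta> j = cube (c j) (r j)"
    and \<eta>0: "\<And>j. 0 < snd (c j)" and r_ge: "\<And>j. \<kappa> * snd (c j) \<le> r j"
    and r_le: "\<And>j. r j \<le> snd (c j)" and bot: "\<And>j. \<kappa> * snd (c j) \<le> snd (c j) - r j"
    by (fact whitney_cubes[OF W])
  have r0: "0 < r j" for j using r_ge[of j] \<kappa> \<eta>0[of j] by (smt (verit) mult_pos_pos)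
  have "compact (cube (0 :: (real ^ 'n) \<times> real) 1)" by (simp add: cube_def compact_cbox)
  moreover have "cube 0 1 \<subseteq> (\<Union>a\<in>cube (0 :: (real ^ 'n) \<times> real) 1. ball a (\<kappa> * \<epsilon>))"
    using \<kappa> \<epsilon> by (intro subsetI UN_I) auto
  ultimately obtain A where A: "finite A" "A \<subseteq> cube (0 :: (real ^ 'n) \<times> real) 1"
    "cube 0 1 \<subseteq> (\<Union>a\<in>A. ball a (\<kappa> * \<epsilon>))"
    by (rule compactE_image[OF _ open_ball]) auto
  \<comment> \<open>There are \<open>card A\<close> balls, centred at height at most 2 \<eta>_j <= 2
    r_j / \<kappa>, whence the factor (1 / \<kappa>)^s relative to (2 r_j)^s; the added 1 keeps
    \<open>K\<close> positive.\<close>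
  define K where "K = (card A + 1) * L * (1 / \<kappa>) powr s"
  have meas: "measure lborel (\<Delta> j) = (2 * r j) ^ (CARD('n) + 1)" for j
    using r0[of j] by (simp add: \<Delta> measure_cube)
  show thesis
  proof (rule that[of K])
    show "0 < K" using L \<kappa> by (simp add: K_def)
    fix j
    define \<zeta> where "\<zeta> a = c j + r j *\<^sub>R a" for a
    have \<zeta>: "\<kappa> * snd (c j) \<le> snd (\<zeta> a)" "snd (\<zeta> a) \<le> 2 * snd (c j)" if "a \<in> A" for a
    proof -
      have "\<bar>snd a\<bar> \<le> 1" using cube_snd[of a 0 1] A that by auto
      then have "r j * \<bar>snd a\<bar> \<le> r j" using r0[of j] by (simp add: mult_left_le)
      then have "\<bar>snd (\<zeta> a) - snd (c j)\<bar> \<le> r j" using r0[of j] by (simp add: \<zeta>_def abs_mult)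
      then show "\<kappa> * snd (c j) \<le> snd (\<zeta> a)" "snd (\<zeta> a) \<le> 2 * snd (c j)"
        using bot[of j] r_le[of j] by linarith+
    qed
    have \<zeta>0: "0 < snd (\<zeta> a)" if "a \<in> A" for a
      using \<zeta>[OF that] \<kappa> \<eta>0[of j] by (smt (verit) mult_pos_pos)
    let ?B = "\<lambda>a. cball (\<zeta> a) (\<epsilon> * snd (\<zeta> a))"
    have sub: "\<Delta> j \<subseteq> (\<Union>a\<in>A. ?B a)"
    proof
      fix z assume z: "z \<in> \<Delta> j"
      have "(1 / r j) *\<^sub>R (z - c j) \<in> cube 0 1"
        using z r0[of j] by (auto simp: \<Delta> mem_cube abs_mult)
      then obtain a where a: "a \<in> A" "dist a ((1 / r j) *\<^sub>R (z - c j)) < \<kappa> * \<epsilon>"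
        using A(3) by auto
      have "\<zeta> a - z = r j *\<^sub>R (a - (1 / r j) *\<^sub>R (z - c j))"
        using r0[of j] by (simp add: \<zeta>_def algebra_simps)
      then have "dist (\<zeta> a) z = r j * dist a ((1 / r j) *\<^sub>R (z - c j))"
        using r0[of j] by (simp add: dist_norm)
      also have "\<dots> \<le> snd (c j) * (\<kappa> * \<epsilon>)"
        using a r_le[of j] r0[of j] \<kappa> \<epsilon> by (intro mult_mono) auto
      also have "\<dots> = \<epsilon> * (\<kappa> * snd (c j))" by simp
      also have "\<dots> \<le> \<epsilon> * snd (\<zeta> a)" using \<zeta>[OF a(1)] \<epsilon> by (intro mult_left_mono) auto
      finally show "z \<in> (\<Union>a\<in>A. ?B a)" using a by auto
    qed
    have sets: "?B a \<in> sets \<mu>" if "a \<in> A" for a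
    proof -
      have "z \<in> half_space" if "z \<in> ?B a" for z
      proof -
        have "\<bar>snd (\<zeta> a) - snd z\<bar> \<le> \<epsilon> * snd (\<zeta> a)"
          using that dist_snd_le[of "\<zeta> a" z] by (auto simp: dist_real_def)
        moreover have "\<epsilon> * snd (\<zeta> a) \<le> 1 / 2 * snd (\<zeta> a)"
          using \<epsilon> \<zeta>0[OF \<open>a \<in> A\<close>] by (intro mult_right_mono) auto
        ultimately show ?thesis using \<zeta>0[OF \<open>a \<in> A\<close>] unfolding mem_half_space by linarith
      qed
      then show ?thesis by (auto simp: sets_half_space_restrict[OF \<mu>])
    qed
    have "emeasure \<mu> (\<Delta> j) \<le> emeasure \<mu> (\<Union>a\<in>A. ?B a)"
      using sub sets A by (intro emeasure_mono sets.finite_UN) auto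
    also have "\<dots> \<le> (\<Sum>a\<in>A. emeasure \<mu> (?B a))"
      using sets A by (intro emeasure_subadditive_finite) auto
    also have "\<dots> \<le> (\<Sum>a\<in>A. ennreal (L * (1 / \<kappa>) powr s * (2 * r j) powr s))"
    proof (rule sum_mono)
      fix a assume a: "a \<in> A"
      have "snd (\<zeta> a) \<le> 1 / \<kappa> * (2 * r j)"
      proof -
        have "snd (c j) \<le> r j / \<kappa>" using r_ge[of j] \<kappa> by (simp add: field_simps)
        moreover have "1 / \<kappa> * (2 * r j) = 2 * (r j / \<kappa>)" by simp
        ultimately show ?thesis using \<zeta>(2)[OF a] by linarith
      qed
      then have "snd (\<zeta> a) powr s \<le> (1 / \<kappa>) powr s * (2 * r j) powr s"
        unfolding powr_mult[symmetric] using \<zeta>0[OF a] s by (intro powr_mono2) auto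
      then have "L * snd (\<zeta> a) powr s \<le> L * (1 / \<kappa>) powr s * (2 * r j) powr s"
        using L by simp
      then have "ennreal (L * snd (\<zeta> a) powr s) \<le> ennreal (L * (1 / \<kappa>) powr s * (2 * r j) powr s)"
        by (rule ennreal_leI)
      with ball[rule_format, OF \<zeta>0[OF a], of "fst (\<zeta> a)"]
      show "emeasure \<mu> (?B a) \<le> ennreal (L * (1 / \<kappa>) powr s * (2 * r j) powr s)"
        by (simp add: s_def)
    qed
    also have "\<dots> = ennreal (card A * (L * (1 / \<kappa>) powr s * (2 * r j) powr s))"
      using L by (simp add: ennreal_mult' ennreal_of_nat_eq_real_of_nat)
    also have "\<dots> \<le> ennreal (K * (2 * r j) powr s)"
      using L by (intro ennreal_leI) (simp add: K_def algebra_simps)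
    also have "(2 * r j) powr s = measure lborel (\<Delta> j) powr (1 + \<alpha> / (real CARD('n) + 1))"
    proof -
      have "measure lborel (\<Delta> j) = (2 * r j) powr real (CARD('n) + 1)"
        unfolding meas by (rule powr_realpow[symmetric]) (use r0 in simp)
      moreover have "real (CARD('n) + 1) * (1 + \<alpha> / (real CARD('n) + 1)) = s"
      proof -
        have "d * (1 + \<alpha> / d) = d + \<alpha>" if "d > 0" for d :: real using that by (simp add: field_simps)
        from this[of "real (CARD('n) + 1)"] show ?thesis by (simp add: s_def add.commute)
      qed
      ultimately show ?thesis by (simp only: powr_powr)
    qed
    finally show "emeasure \<mu> (\<Delta> j) \<le> ennreal (K * measure lborel (\<Delta> j) powr (1 + \<alpha> / (real CARD('n) + 1)))" .
  qed
qed

text \<open>Ensures that the denominator in the quotient condition is nonzero, so that it can be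
  cleared in the extended reals.\<close>

lemma measure_whitney_pos:
  assumes "whitney_decomposition \<Delta>"
  shows "0 < measure lborel (\<Delta> j)"
proof -
  have "closed_cube (\<Delta> j)" using assms by (simp add: whitney_decomposition_def)
  then obtain c r where "0 < r" "\<Delta> j = cube c r"
    unfolding closed_cube_def cube_def by blast
  then show ?thesis by (simp add: measure_cube)
qed

theorem theorem8:
  fixes \<alpha> p q :: real
    and \<mu> :: "((real ^ 'n) \<times> real) measure"
    and \<Delta> :: "nat \<Rightarrow> ((real ^ 'n) \<times> real) set"
  assumes "- 1 < \<alpha>" and "0 < p" and "p \<le> q"
    and "sets \<mu> = sets (restrict_space borel half_space)"
    and "whitney_decomposition \<Delta>"
  shows "(\<exists>C::real. 0 < C \<and> (\<forall>f\<in>bergman_space p \<alpha>.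
            f \<in> K_space \<mu> p q \<and> K_norm \<mu> p q f \<le> ennreal C * bergman_norm p \<alpha> f))
     \<longleftrightarrow> (\<exists>C::real. 0 < C \<and> (\<forall>j.
            emeasure \<mu> (\<Delta> j)
              / ennreal (measure lborel (\<Delta> j) powr (1 + \<alpha> / (real CARD('n) + 1))) \<le> ennreal C))"
    (is "?emb \<longleftrightarrow> ?whitney")
proof
  have pos: "0 < measure lborel (\<Delta> j) powr (1 + \<alpha> / (real CARD('n) + 1))" for j
    using measure_whitney_pos[OF assms(5), of j] by simp
  show ?whitney if emb: ?emb
  proof -
    obtain C where "0 < C" "\<forall>f\<in>bergman_space p \<alpha>. f \<in> K_space \<mu> p q \<and> K_norm \<mu> p q f \<le> ennreal C * bergman_norm p \<alpha> f"
      using emb by (elim exE conjE)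
    then have C: "0 < C" "\<forall>f\<in>bergman_space p \<alpha>. K_norm \<mu> p q f \<le> ennreal C * bergman_norm p \<alpha> f"
      by auto
    obtain \<epsilon> L where "0 < \<epsilon>" "\<epsilon> \<le> 1 / 2" "0 < L"
      "\<forall>(\<xi> :: real ^ 'n). \<forall>\<eta>>0.
        emeasure \<mu> (cball (\<xi>, \<eta>) (\<epsilon> * \<eta>)) \<le> ennreal (L * \<eta> powr (real CARD('n) + 1 + \<alpha>))"
      by (fact K_embedding_imp_ball_bound[OF assms(2,3,1,4) C])
    note ball = this
    obtain K where "0 < K"
      "\<And>j. emeasure \<mu> (\<Delta> j) \<le> ennreal (K * measure lborel (\<Delta> j) powr (1 + \<alpha> / (real CARD('n) + 1)))"
      by (fact ball_bound_imp_whitney_bound[OF assms(1,4,5) ball])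
    then show ?thesis using pos by (auto simp: ennreal_divide_le_iff intro!: exI[of _ K])
  qed
  show ?emb if whitney: ?whitney
  proof -
    obtain K where K: "0 < K"
      "\<And>j. emeasure \<mu> (\<Delta> j) \<le> ennreal (K * measure lborel (\<Delta> j) powr (1 + \<alpha> / (real CARD('n) + 1)))"
      using whitney pos by (auto simp: ennreal_divide_le_iff)
    obtain C where C: "0 < C" "\<And>f. harmonic_on f half_space \<Longrightarrow>
        (\<integral>\<^sup>+z\<in>half_space. ennreal (\<bar>f z\<bar> powr p) \<partial>\<mu>)
          \<le> ennreal C * (\<integral>\<^sup>+z\<in>half_space. ennreal (\<bar>f z\<bar> powr p * snd z powr \<alpha>) \<partial>lborel)"
      by (fact whitney_embedding[OF assms(2,1,4,5) K])
    show ?thesis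
      using C(1) carleson_imp_K_embedding[OF assms(2,3,4) C]
      by (intro exI[of _ "C powr (1 / p)"]) auto
  qed
qed

end
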